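(* (a) Let $d=1$ and let $\mu$ be a translation invariant product probability measure on $\mathbb{N}^{\mathbb{Z}}$ with $\mathbb{E}_\mu(e^{t\eta(0)})<\infty$ for all $t\in\mathbb{R}$ and density $\rho=\mathbb{E}_\mu(\eta(0))<1$. Then there is a constant $c_1>0$ such that for all $n$, $\mathbb{P}_\mu(|\mathcal{T}_\infty(0)|\ge n)\le e^{-c_1n}$. (b) Let $d>1$ and let $(\mu_\rho)_{0<\rho<1}$ be a family of translation invariant product probability measures on $\mathbb{N}^{\mathbb{Z}^d}$ satisfying: (i) $G_\rho(t)=\mathbb{E}_{\mu_\rho}(e^{t\eta(0)})<\infty$ for all $t\in\mathbb{R}$; (ii) $\mathbb{E}_{\mu_\rho}(\eta(0))=\rho$; (iii) whenever $a_\rho\ge0$ with $a_\rho\to\infty$ as $\rho\to0$, also $\sup\{x:G_\rho(x)\le a_\rho\}\to\infty$ as $\rho\to0$. Then for all $\rho$ sufficiently small there is a constant $c_d=c_d(d,\rho)>0$ such that for all $n$, $\mathbb{P}_{\mu_\rho}(|\mathcal{T}_\infty(0)|\ge n)\le e^{-c_dn}$.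
   Context: Sandpile model on $\mathbb{Z}^d$: $\eta\in\mathbb{N}^{\mathbb{Z}^d}$, site $x$ unstable if $\eta(x)\ge 2d$; toppling $x$ removes $2d$ grains from $x$ and adds one to each of its $2d$ nearest neighbors. A configuration $\eta$ is stabilizable if there is a legal toppling procedure (topplings of unstable sites only, occurring at times in $[0,\infty)$, finitely many per site in bounded time, no infinite backward chain of topplings at neighboring sites at decreasing times) in which every site topples finitely often and the final configuration $\eta_\infty$ is stable ($\eta_\infty(x)\le 2d-1$ for all $x$); then the number of topplings at each site, and $\eta_\infty$, do not depend on the chosen stabilizing procedure. (It is known that translation invariant measures with density $<d$ are stabilizable, so the measures in the theorem are stabilizable a.s.) For stabilizable $\eta$, $\mathcal{T}_\infty$ is the set of sites that topple at least once during stabilization, and $\mathcal{T}_\infty(0)$ is the connected component (for nearest-neighbor adjacency) of $\mathcal{T}_\infty$ containing the origin (empty if the origin does not topple); $|\cdot|$ denotes cardinality. *)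

theory Defs
  imports "HOL-Probability.Probability"
begin

definition sites :: "nat \<Rightarrow> int list set" where
  "sites d = {x. length x = d}"

definition origin :: "nat \<Rightarrow> int list" where
  "origin d = replicate d 0"

definition adj :: "int list \<Rightarrow> int list \<Rightarrow> bool" where
  "adj x y \<longleftrightarrow> length x = length y \<and> (\<Sum>i<length x. \<bar>x ! i - y ! i\<bar>) = 1"

definition nbrs :: "int list \<Rightarrow> int list set" where
  "nbrs x = {y. adj x y}"

text \<open>A toppling procedure assigns to each site the set of times at which it topples.
  Number of topplings at x strictly before time s:\<close>
definition topp_before :: "(int list \<Rightarrow> real set) \<Rightarrow> int list \<Rightarrow> real \<Rightarrow> nat" where
  "topp_before T x s = card {u \<in> T x. u < s}"

definition height_before ::
  "nat \<Rightarrow> (int list \<Rightarrow> nat) \<Rightarrow> (int list \<Rightarrow> real set) \<Rightarrow> int list \<Rightarrow> real \<Rightarrow> int" where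
  "height_before d \<eta> T x s =
     int (\<eta> x) + (\<Sum>y\<in>nbrs x. int (topp_before T y s)) - 2 * int d * int (topp_before T x s)"

definition legal_procedure :: "nat \<Rightarrow> (int list \<Rightarrow> nat) \<Rightarrow> (int list \<Rightarrow> real set) \<Rightarrow> bool" where
  "legal_procedure d \<eta> T \<longleftrightarrow>
     (\<forall>x. x \<notin> sites d \<longrightarrow> T x = {}) \<and>
     (\<forall>x. T x \<subseteq> {0..}) \<and>
     (\<forall>x t. finite (T x \<inter> {..t})) \<and>
     \<not> (\<exists>xs ss. \<forall>n. adj (xs n) (xs (Suc n)) \<and> ss n \<in> T (xs n) \<and> ss (Suc n) < ss n) \<and>
     (\<forall>x \<in> sites d. \<forall>s \<in> T x. height_before d \<eta> T x s \<ge> 2 * int d)"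

text \<open>Final configuration of a procedure in which every site topples finitely often.\<close>
definition final_height :: "nat \<Rightarrow> (int list \<Rightarrow> nat) \<Rightarrow> (int list \<Rightarrow> real set) \<Rightarrow> int list \<Rightarrow> int" where
  "final_height d \<eta> T x =
     int (\<eta> x) + (\<Sum>y\<in>nbrs x. int (card (T y))) - 2 * int d * int (card (T x))"

definition stabilizing :: "nat \<Rightarrow> (int list \<Rightarrow> nat) \<Rightarrow> (int list \<Rightarrow> real set) \<Rightarrow> bool" where
  "stabilizing d \<eta> T \<longleftrightarrow> legal_procedure d \<eta> T \<and> (\<forall>x. finite (T x)) \<and>
     (\<forall>x \<in> sites d. final_height d \<eta> T x \<le> 2 * int d - 1)"

definition stabilizable :: "nat \<Rightarrow> (int list \<Rightarrow> nat) \<Rightarrow> bool" where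
  "stabilizable d \<eta> \<longleftrightarrow> (\<exists>T. stabilizing d \<eta> T)"

text \<open>Set T_infinity of sites toppling at least once (independent of the chosen
  stabilizing procedure, so any one may be picked).\<close>
definition toppled :: "nat \<Rightarrow> (int list \<Rightarrow> nat) \<Rightarrow> int list set" where
  "toppled d \<eta> = {x. (SOME T. stabilizing d \<eta> T) x \<noteq> {}}"

definition origin_component :: "nat \<Rightarrow> int list set \<Rightarrow> int list set" where
  "origin_component d S =
     {y. origin d \<in> S \<and> (\<lambda>a b. a \<in> S \<and> b \<in> S \<and> adj a b)\<^sup>*\<^sup>* (origin d) y}"

definition sandpile_measure :: "nat \<Rightarrow> nat pmf \<Rightarrow> (int list \<Rightarrow> nat) measure" where
  "sandpile_measure d p = PiM (sites d) (\<lambda>_. measure_pmf p)"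

definition big_cluster_event :: "nat \<Rightarrow> nat pmf \<Rightarrow> nat \<Rightarrow> (int list \<Rightarrow> nat) set" where
  "big_cluster_event d p n =
     {\<eta> \<in> space (sandpile_measure d p). stabilizable d \<eta> \<and>
        \<not> (finite (origin_component d (toppled d \<eta>)) \<and>
           card (origin_component d (toppled d \<eta>)) < n)}"

definition mgf :: "nat pmf \<Rightarrow> real \<Rightarrow> real" where
  "mgf p t = measure_pmf.expectation p (\<lambda>k. exp (t * real k))"

end

theory Submission
  imports Defs
begin

text \<open>
  Toppling sites one at a time in a fixed order that visits every site infinitely often
  produces the same toppled set as any stabilizing procedure, and shows it as an increasing union
  of finite sets, each of them the toppled set of a finite legal sequence. After such a sequence
  let \<open>C\<close> be a component of the toppled set. Each edge inside \<open>C\<close> carries a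
  grain that is still at the endpoint whose last toppling came first, and each edge leaving
  \<open>C\<close> has carried a grain away; hence \<open>C\<close> initially held at least
  \<open>d * card C\<close> grains. It remains to bound the probability of a heavy connected set
  of size \<open>m\<close> around the origin by the number of shapes times a Chernoff bound. For
  \<open>d = 1\<close> there are only \<open>m\<close> intervals, so density below \<open>1\<close>
  suffices; for \<open>d > 1\<close> the exponential number of shapes is beaten by taking the
  exponential moment at a fixed large \<open>t\<close>, where \<open>G(t) \<le> 2\<close> for small
  densities.
\<close>

section \<open>Greedy toppling\<close>

lemma adj_sym: "adj x y \<longleftrightarrow> adj y x"
  by (auto simp: adj_def abs_minus_commute)

lemma not_adj_self [simp]: "\<not> adj x x"
  by (simp add: adj_def)

lemma adj_sites: "adj x y \<Longrightarrow> x \<in> sites d \<longleftrightarrow> y \<in> sites d"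
  by (auto simp: adj_def sites_def)

lemma in_nbrs [simp]: "y \<in> nbrs x \<longleftrightarrow> adj x y"
  by (simp add: nbrs_def)

text \<open>Nonnegative integers that sum to one consist of a single one and zeros, so exactly one
  coordinate moves, by one unit. The coordinate and the sign of the move then give both finiteness
  of \<open>nbrs x\<close> and the bound by twice the dimension.\<close>

lemma nbrs_subset:
  "nbrs x \<subseteq> (\<lambda>(i, s). x[i := x ! i + s]) ` ({..<length x} \<times> {1, -1})"
proof
  fix y assume "y \<in> nbrs x"
  then have len: "length y = length x" and s: "(\<Sum>i<length x. \<bar>x ! i - y ! i\<bar>) = 1"
    by (auto simp: adj_def)
  obtain i where i: "i < length x" "x ! i \<noteq> y ! i"
    using s by (metis (mono_tags, lifting) abs_zero diff_self lessThan_iff sum.neutral zero_neq_one)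
  have split: "(\<Sum>j<length x. \<bar>x ! j - y ! j\<bar>)
      = \<bar>x ! i - y ! i\<bar> + (\<Sum>j\<in>{..<length x} - {i}. \<bar>x ! j - y ! j\<bar>)"
    using i by (intro sum.remove) auto
  have nn: "(\<Sum>j\<in>{..<length x} - {i}. \<bar>x ! j - y ! j\<bar>) \<ge> 0"
    by (intro sum_nonneg) auto
  have one: "\<bar>x ! i - y ! i\<bar> = 1" and "(\<Sum>j\<in>{..<length x} - {i}. \<bar>x ! j - y ! j\<bar>) = 0"
    using split s nn i(2) by linarith+
  then have same: "x ! j = y ! j" if "j < length x" "j \<noteq> i" for j
    using that by (subst (asm) sum_nonneg_eq_0_iff) auto
  have "y = x[i := x ! i + (y ! i - x ! i)]"
    using len same i(1) by (intro nth_equalityI) (auto simp: nth_list_update)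
  moreover have "y ! i - x ! i \<in> {1, -1}" using one by auto
  ultimately show "y \<in> (\<lambda>(i, s). x[i := x ! i + s]) ` ({..<length x} \<times> {1, -1})"
    using i by (intro image_eqI[of _ _ "(i, y ! i - x ! i)"]) auto
qed

lemma finite_nbrs [simp]: "finite (nbrs x)"
  by (rule finite_subset[OF nbrs_subset]) auto

lemma card_nbrs_le: "card (nbrs x) \<le> 2 * length x"
proof -
  have "card (nbrs x) \<le> card ((\<lambda>(i, s). x[i := x ! i + s]) ` ({..<length x} \<times> {1, -1::int}))"
    by (rule card_mono[OF _ nbrs_subset]) auto
  also have "\<dots> \<le> card ({..<length x} \<times> {1, -1::int})" by (rule card_image_le) auto
  also have "\<dots> = 2 * length x" by (simp add: card_cartesian_product)
  finally show ?thesis .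
qed

text \<open>The toppling counts are an arbitrary function, so that one formula covers the counts of
  a procedure before a time, its final counts, and the greedy odometer.\<close>

definition height :: "nat \<Rightarrow> (int list \<Rightarrow> nat) \<Rightarrow> (int list \<Rightarrow> nat) \<Rightarrow> int list \<Rightarrow> int" where
  "height d \<eta> n x = int (\<eta> x) + (\<Sum>y\<in>nbrs x. int (n y)) - 2 * int d * int (n x)"

lemma height_before_eq: "height_before d \<eta> T x s = height d \<eta> (\<lambda>y. topp_before T y s) x"
  by (simp add: height_before_def height_def)

lemma final_height_eq: "final_height d \<eta> T x = height d \<eta> (\<lambda>y. card (T y)) x"
  by (simp add: final_height_def height_def)

section \<open>The greedy odometer\<close>

definition site_enum :: "nat \<Rightarrow> int list" where
  "site_enum k = fst (from_nat k :: int list \<times> nat)"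

text \<open>Codes of pairs of a site and an index are enumerated and the index is dropped, so a site
  recurs once for each index.\<close>

lemma site_enum_recurs: "\<exists>k\<ge>K. site_enum k = x"
proof (rule ccontr)
  assume "\<not> ?thesis"
  then have "range (\<lambda>j::nat. to_nat (x, j)) \<subseteq> {..<K}"
    by (force simp: site_enum_def not_le)
  moreover have "infinite (range (\<lambda>j::nat. to_nat (x, j)))"
    by (intro range_inj_infinite) (auto intro: injI)
  ultimately show False using finite_subset by blast
qed

text \<open>The counts are an argument because the recursion for \<open>odo\<close> uses this test.
  The enumeration runs through integer lists of every length, hence the condition on
  \<open>sites d\<close>.\<close>

definition fires :: "nat \<Rightarrow> (int list \<Rightarrow> nat) \<Rightarrow> (int list \<Rightarrow> nat) \<Rightarrow> nat \<Rightarrow> bool" where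
  "fires d \<eta> n k \<longleftrightarrow> site_enum k \<in> sites d \<and> 2 * int d \<le> height d \<eta> n (site_enum k)"

primrec odo :: "nat \<Rightarrow> (int list \<Rightarrow> nat) \<Rightarrow> nat \<Rightarrow> int list \<Rightarrow> nat" where
  "odo d \<eta> 0 = (\<lambda>x. 0)"
| "odo d \<eta> (Suc k) = (\<lambda>x. odo d \<eta> k x + of_bool (site_enum k = x \<and> fires d \<eta> (odo d \<eta> k) k))"

abbreviation fires_at :: "nat \<Rightarrow> (int list \<Rightarrow> nat) \<Rightarrow> nat \<Rightarrow> bool" where
  "fires_at d \<eta> k \<equiv> fires d \<eta> (odo d \<eta> k) k"

definition greedy :: "nat \<Rightarrow> (int list \<Rightarrow> nat) \<Rightarrow> int list \<Rightarrow> nat set" where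
  "greedy d \<eta> x = {k. site_enum k = x \<and> fires_at d \<eta> k}"

definition greedy_toppled :: "nat \<Rightarrow> (int list \<Rightarrow> nat) \<Rightarrow> nat \<Rightarrow> int list set" where
  "greedy_toppled d \<eta> k = {x. 0 < odo d \<eta> k x}"

lemma odo_mono: "k \<le> l \<Longrightarrow> odo d \<eta> k x \<le> odo d \<eta> l x"
  by (rule lift_Suc_mono_le[of "\<lambda>k. odo d \<eta> k x"]) auto

lemma odo_eq_card: "odo d \<eta> k x = card (greedy d \<eta> x \<inter> {..<k})"
proof (induction k)
  case (Suc k)
  have "greedy d \<eta> x \<inter> {..<Suc k}
      = (if k \<in> greedy d \<eta> x then insert k (greedy d \<eta> x \<inter> {..<k}) else greedy d \<eta> x \<inter> {..<k})"
    by (auto simp: less_Suc_eq)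
  then show ?case using Suc by (simp add: greedy_def)
qed auto

lemma odo_outside: "x \<notin> sites d \<Longrightarrow> odo d \<eta> k x = 0"
  by (induction k) (auto simp: fires_def)

lemma greedy_toppled_subset: "greedy_toppled d \<eta> k \<subseteq> site_enum ` {..<k} \<inter> sites d"
proof -
  have "x \<in> site_enum ` {..<k}" if "0 < odo d \<eta> k x" for x
    using that by (auto simp: odo_eq_card card_gt_0_iff greedy_def)
  then show ?thesis using odo_outside by (fastforce simp: greedy_toppled_def)
qed

lemma finite_greedy_toppled [simp]: "finite (greedy_toppled d \<eta> k)"
  using greedy_toppled_subset finite_subset by (metis finite_Int finite_imageI finite_lessThan)

lemma greedy_toppled_mono: "k \<le> l \<Longrightarrow> greedy_toppled d \<eta> k \<subseteq> greedy_toppled d \<eta> l"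
  by (auto simp: greedy_toppled_def intro: less_le_trans odo_mono)

text \<open>Least action principle. At a first violation \<open>x\<close> fires although it has
  already used up its \<open>card (T x)\<close> topplings. Its neighbours have not passed their
  final counts, so \<open>x\<close> is at most as high as in the final configuration of
  \<open>T\<close>, which is stable.\<close>

lemma odo_le_stabilizing:
  assumes "stabilizing d \<eta> T"
  shows "odo d \<eta> k x \<le> card (T x)"
proof (induction k arbitrary: x)
  case (Suc k)
  show ?case
  proof (cases "site_enum k = x \<and> fires_at d \<eta> k \<and> odo d \<eta> k x = card (T x)")
    case True
    then have x: "x \<in> sites d" and "2 * int d \<le> height d \<eta> (odo d \<eta> k) x"
      by (auto simp: fires_def)
    moreover have "height d \<eta> (odo d \<eta> k) x \<le> height d \<eta> (\<lambda>y. card (T y)) x"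
      using True Suc by (auto simp: height_def intro!: sum_mono)
    moreover have "height d \<eta> (\<lambda>y. card (T y)) x \<le> 2 * int d - 1"
      using assms x by (auto simp: stabilizing_def final_height_eq)
    ultimately show ?thesis by linarith
  next
    case False
    then show ?thesis using Suc[of x] by auto
  qed
qed auto

text \<open>Used on sets of toppling times, to select the toppling that is preceded by exactly
  \<open>n\<close> others.\<close>

lemma finite_set_nth_element:
  fixes A :: "real set"
  assumes "finite A" "n < card A"
  shows "\<exists>u\<in>A. card {v\<in>A. v < u} = n"
proof -
  let ?l = "sorted_list_of_set A"
  have len: "length ?l = card A" by simp
  have st: "sorted_wrt (<) ?l" by simp
  have "{v\<in>A. v < ?l ! n} = (!) ?l ` {..<n}"
  proof (intro equalityI subsetI)
    fix v assume v: "v \<in> {v\<in>A. v < ?l ! n}"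
    then obtain i where i: "i < card A" "v = ?l ! i"
      using assms(1) len by (metis (no_types, lifting) in_set_conv_nth mem_Collect_eq set_sorted_list_of_set)
    have "i < n"
    proof (rule ccontr)
      assume "\<not> i < n"
      then have "?l ! n \<le> ?l ! i" using i len by (intro sorted_nth_mono) auto
      then show False using v i by auto
    qed
    then show "v \<in> (!) ?l ` {..<n}" using i by auto
  next
    fix v assume "v \<in> (!) ?l ` {..<n}"
    then obtain i where i: "i < n" "v = ?l ! i" by auto
    moreover have "?l ! i < ?l ! n" using i assms len st by (simp add: sorted_wrt_nth_less)
    moreover have "?l ! i \<in> A" using i assms len
      by (metis less_trans nth_mem set_sorted_list_of_set)
    ultimately show "v \<in> {v\<in>A. v < ?l ! n}" by auto
  qed
  moreover have "card ((!) ?l ` {..<n}) = n"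
    using assms len by (subst card_image) (auto intro!: inj_onI simp: nth_eq_iff_index_eq)
  moreover have "?l ! n \<in> A" using assms len by (metis nth_mem set_sorted_list_of_set)
  ultimately show ?thesis by (intro bexI[of _ "?l ! n"]) simp_all
qed

text \<open>A toppling of \<open>x\<close> beyond the bound \<open>N x\<close> forces an earlier excess toppling at a
  neighbour of \<open>x\<close>; iterating would give an infinite backward chain.\<close>
lemma legal_le_stable:
  assumes legal: "legal_procedure d \<eta> T"
    and stable: "\<And>x. x \<in> sites d \<Longrightarrow> height d \<eta> N x < 2 * int d"
  shows "finite (T x) \<and> card (T x) \<le> N x"
proof (rule ccontr)
  assume neg: "\<not> ?thesis"
  have fin: "finite {u \<in> T y. u < s}" for y s
  proof (rule finite_subset)
    show "{u \<in> T y. u < s} \<subseteq> T y \<inter> {..s}" by auto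
    show "finite (T y \<inter> {..s})" using legal by (simp add: legal_procedure_def)
  qed
  \<comment> \<open>Exactly \<open>N y\<close> earlier topplings: this is the first toppling at
    \<open>y\<close> beyond the bound.\<close>
  define excess where "excess = (\<lambda>(y, s). s \<in> T y \<and> topp_before T y s = N y)"
  have step: "\<exists>y u. excess (y, u) \<and> adj z y \<and> u < s" if ex: "excess (z, s)" for z s
  proof -
    have z: "z \<in> sites d" and s: "s \<in> T z" "topp_before T z s = N z"
      using ex legal by (auto simp: excess_def legal_procedure_def)
    have "2 * int d \<le> height d \<eta> (\<lambda>y. topp_before T y s) z"
      using legal z s by (auto simp: legal_procedure_def height_before_eq)
    \<comment> \<open>At \<open>z\<close> itself both counts equal \<open>N z\<close>, so the gap in
      height must come from a neighbour that has already passed its bound.\<close>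
    then have "height d \<eta> N z < height d \<eta> (\<lambda>y. topp_before T y s) z"
      using stable[OF z] by linarith
    then have "(\<Sum>y\<in>nbrs z. int (N y)) < (\<Sum>y\<in>nbrs z. int (topp_before T y s))"
      using s by (simp add: height_def)
    then obtain y where y: "y \<in> nbrs z" "N y < topp_before T y s"
      by (meson not_le of_nat_mono sum_mono)
    then obtain u where u: "u \<in> T y" "u < s" "card {v \<in> {v \<in> T y. v < s}. v < u} = N y"
      using finite_set_nth_element[OF fin[of y s], of "N y"] by (auto simp: topp_before_def)
    have "{v \<in> {v \<in> T y. v < s}. v < u} = {v \<in> T y. v < u}" using u by auto
    then show ?thesis using u y by (auto simp: excess_def topp_before_def)
  qed
  have "\<exists>s. excess (x, s)"
  proof -
    obtain A where A: "A \<subseteq> T x" "finite A" "card A = Suc (N x)"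
      by (metis neg card_mono infinite_arbitrarily_large not_less_eq_eq obtain_subset_with_card_n)
    define t where "t = Max A + 1"
    have "A \<subseteq> {u \<in> T x. u < t}" using A by (auto simp: t_def intro: le_less_trans[OF Max_ge])
    then have "N x < card {u \<in> T x. u < t}"
      using A card_mono[OF fin] by (metis Suc_le_eq)
    from finite_set_nth_element[OF fin this] obtain u where
      u: "u \<in> T x" "u < t" "card {v \<in> {v \<in> T x. v < t}. v < u} = N x" by auto
    have "{v \<in> {v \<in> T x. v < t}. v < u} = {v \<in> T x. v < u}" using u by auto
    then show ?thesis using u by (auto simp: excess_def topp_before_def)
  qed
  then obtain s0 where s0: "excess (x, s0)" by auto
  have "\<exists>f. \<forall>n. excess (f n) \<and> (adj (fst (f n)) (fst (f (Suc n))) \<and> snd (f (Suc n)) < snd (f n))"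
  proof (rule dependent_nat_choice)
    show "\<exists>p. excess p" using s0 by auto
    show "\<exists>q. excess q \<and> (adj (fst p) (fst q) \<and> snd q < snd p)" if "excess p" for p n
      using step[of "fst p" "snd p"] that by force
  qed
  then obtain f where f: "\<And>n. excess (f n)"
    "\<And>n. adj (fst (f n)) (fst (f (Suc n)))" "\<And>n. snd (f (Suc n)) < snd (f n)" by blast
  have "snd (f n) \<in> T (fst (f n))" for n using f(1)[of n] by (auto simp: excess_def case_prod_beta)
  then have "\<exists>xs ss. \<forall>n. adj (xs n) (xs (Suc n)) \<and> ss n \<in> T (xs n) \<and> ss (Suc n) < ss n"
    using f by (intro exI[of _ "\<lambda>n. fst (f n)"] exI[of _ "\<lambda>n. snd (f n)"]) auto
  then show False using legal by (simp add: legal_procedure_def)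
qed

text \<open>Stands in for stabilizability: the quantifier over real-time procedures is replaced by
  countable quantifiers, from which measurability follows.\<close>

definition greedy_bounded :: "nat \<Rightarrow> (int list \<Rightarrow> nat) \<Rightarrow> bool" where
  "greedy_bounded d \<eta> \<longleftrightarrow> (\<forall>x. \<exists>B. \<forall>k. odo d \<eta> k x \<le> B)"

lemma finite_greedy:
  assumes "greedy_bounded d \<eta>"
  shows "finite (greedy d \<eta> x)"
proof (rule ccontr)
  assume inf: "infinite (greedy d \<eta> x)"
  obtain B where B: "\<And>k. odo d \<eta> k x \<le> B" using assms by (auto simp: greedy_bounded_def)
  obtain A where A: "A \<subseteq> greedy d \<eta> x" "finite A" "card A = Suc B"
    using inf infinite_arbitrarily_large by metis
  obtain k where "A \<subseteq> {..<k}" using A finite_nat_iff_bounded by blast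
  then have "card A \<le> card (greedy d \<eta> x \<inter> {..<k})" using A by (intro card_mono) auto
  then show False using A B[of k] by (simp add: odo_eq_card)
qed

lemma eventually_odo:
  assumes "finite (greedy d \<eta> x)"
  shows "\<forall>\<^sub>F k in sequentially. odo d \<eta> k x = card (greedy d \<eta> x)"
proof -
  obtain K where "greedy d \<eta> x \<subseteq> {..<K}" using assms finite_nat_iff_bounded by blast
  then have "greedy d \<eta> x \<inter> {..<k} = greedy d \<eta> x" if "K \<le> k" for k using that by fastforce
  then show ?thesis
    unfolding eventually_sequentially odo_eq_card by (intro exI[of _ K]) auto
qed

text \<open>If \<open>x\<close> were unstable under the final counts, it would fire at a visit made
  after the counts at \<open>x\<close> and its neighbours have settled and after its own last
  toppling.\<close>

lemma greedy_final_stable: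
  assumes b: "greedy_bounded d \<eta>" and x: "x \<in> sites d"
  shows "height d \<eta> (\<lambda>y. card (greedy d \<eta> y)) x < 2 * int d"
proof (rule ccontr)
  assume unst: "\<not> ?thesis"
  have "\<forall>\<^sub>F k in sequentially. \<forall>y\<in>insert x (nbrs x). odo d \<eta> k y = card (greedy d \<eta> y)"
    by (intro eventually_ball_finite ballI eventually_odo finite_greedy b) auto
  moreover obtain M where "greedy d \<eta> x \<subseteq> {..<M}"
    using finite_greedy[OF b] finite_nat_iff_bounded by blast
  ultimately obtain K where
    K: "\<And>k y. k \<ge> K \<Longrightarrow> y \<in> insert x (nbrs x) \<Longrightarrow> odo d \<eta> k y = card (greedy d \<eta> y)"
    and M: "greedy d \<eta> x \<subseteq> {..<M}"
    unfolding eventually_sequentially by blast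
  obtain k where k: "k \<ge> max K M" "site_enum k = x" using site_enum_recurs by blast
  have "height d \<eta> (odo d \<eta> k) x = height d \<eta> (\<lambda>y. card (greedy d \<eta> y)) x"
    using K[of k] k by (auto simp: height_def intro!: sum.cong)
  then have "k \<in> greedy d \<eta> x" using unst k x by (auto simp: greedy_def fires_def)
  then show False using M k by auto
qed

text \<open>Step numbers serve as times. They are natural numbers, so an infinite backward chain is
  impossible.\<close>

lemma greedy_stabilizing:
  assumes b: "greedy_bounded d \<eta>"
  shows "stabilizing d \<eta> (\<lambda>x. real ` greedy d \<eta> x)"
proof -
  let ?T = "\<lambda>x. real ` greedy d \<eta> x"
  have tb: "topp_before ?T x (real k) = odo d \<eta> k x" for x k
  proof -
    have "{u \<in> real ` greedy d \<eta> x. u < real k} = real ` (greedy d \<eta> x \<inter> {..<k})" by auto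
    then show ?thesis by (simp add: topp_before_def odo_eq_card card_image)
  qed
  have chain: "\<not> (\<exists>xs ss. \<forall>n. adj (xs n) (xs (Suc n)) \<and> ss n \<in> ?T (xs n) \<and> ss (Suc n) < ss n)"
  proof
    assume "\<exists>xs ss. \<forall>n. adj (xs n) (xs (Suc n)) \<and> ss n \<in> ?T (xs n) \<and> ss (Suc n) < ss n"
    then obtain xs ss where c: "\<And>n. ss n \<in> ?T (xs n)" "\<And>n. ss (Suc n) < ss n" by blast
    have "\<exists>m. ss n = real m" for n using c(1)[of n] by auto
    then obtain m where "\<And>n. ss n = real (m n)" by metis
    then have "m (Suc n) < m n" for n using c(2)[of n] by simp
    then show False using wf_iff_no_infinite_down_chain[of less_than] wf_less_than by auto
  qed
  have "legal_procedure d \<eta> ?T"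
    unfolding legal_procedure_def
  proof (intro conjI allI impI ballI chain)
    show "?T x = {}" if "x \<notin> sites d" for x using that by (auto simp: greedy_def fires_def)
    show "finite (?T x \<inter> {..t})" for x t using finite_greedy[OF b] by auto
    show "height_before d \<eta> ?T x s \<ge> 2 * int d" if sx: "s \<in> ?T x" for x s
    proof -
      obtain k where "s = real k" "k \<in> greedy d \<eta> x" using sx by auto
      then show ?thesis by (simp add: height_before_eq tb) (auto simp: greedy_def fires_def)
    qed
  qed auto
  then show ?thesis
    using greedy_final_stable[OF b] finite_greedy[OF b]
    by (fastforce simp: stabilizing_def final_height_eq card_image)
qed

lemma stabilizable_iff: "stabilizable d \<eta> \<longleftrightarrow> greedy_bounded d \<eta>"
  unfolding stabilizable_def greedy_bounded_def
  using greedy_stabilizing[unfolded greedy_bounded_def] odo_le_stabilizing by blast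

text \<open>The chosen procedure is squeezed between greedy counts: it dominates every
  \<open>odo d \<eta> k\<close>, and by legality it stays below the final greedy counts because
  these are stable.\<close>

lemma toppled_eq:
  assumes "stabilizable d \<eta>"
  shows "toppled d \<eta> = (\<Union>k. greedy_toppled d \<eta> k)"
proof -
  let ?T = "SOME T. stabilizing d \<eta> T"
  have T: "stabilizing d \<eta> ?T"
    using assms unfolding stabilizable_def by (rule someI_ex)
  have b: "greedy_bounded d \<eta>" using assms stabilizable_iff by blast
  have "?T x \<noteq> {} \<longleftrightarrow> (\<exists>k. 0 < odo d \<eta> k x)" for x
  proof
    assume "?T x \<noteq> {}"
    moreover have "card (?T x) \<le> card (greedy d \<eta> x)" "finite (?T x)"
      using legal_le_stable[of d \<eta> ?T] greedy_final_stable[OF b] T by (auto simp: stabilizing_def)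
    ultimately have "0 < card (greedy d \<eta> x)" by (metis card_gt_0_iff less_le_trans)
    then show "\<exists>k. 0 < odo d \<eta> k x"
      using eventually_odo[OF finite_greedy[OF b], of x] unfolding eventually_sequentially
      by (metis order_refl)
  next
    assume "\<exists>k. 0 < odo d \<eta> k x"
    then show "?T x \<noteq> {}" using odo_le_stabilizing[OF T, of _ x] by force
  qed
  then show ?thesis by (auto simp: toppled_def greedy_toppled_def)
qed

section \<open>Mass of toppled clusters\<close>

text \<open>An injective \<open>l\<close> orients every edge between toppled sites towards the
  endpoint that toppled last; the second condition says that a grain is still present for each
  outgoing edge.\<close>

definition last_ordered :: "nat \<Rightarrow> (int list \<Rightarrow> nat) \<Rightarrow> (int list \<Rightarrow> nat) \<Rightarrow> (int list \<Rightarrow> nat) \<Rightarrow> bool" where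
  "last_ordered d \<eta> n l \<longleftrightarrow> inj_on l {x. 0 < n x} \<and>
     (\<forall>x. 0 < n x \<longrightarrow> int (card {y \<in> nbrs x. 0 < n y \<and> l x < l y}) \<le> height d \<eta> n x)"

text \<open>The label \<open>l x\<close> is the time of the last toppling of \<open>x\<close>: since then \<open>x\<close> has received
  a grain from each neighbour that toppled later.\<close>
lemma last_ordered_odo:
  "\<exists>l. (\<forall>x. l x \<le> k) \<and> last_ordered d \<eta> (odo d \<eta> k) l"
proof (induction k)
  case 0
  show ?case by (intro exI[of _ "\<lambda>_. 0"]) (auto simp: last_ordered_def)
next
  case (Suc k)
  then obtain l where l: "\<And>x. l x \<le> k" and lo: "last_ordered d \<eta> (odo d \<eta> k) l" by blast
  define n where "n = odo d \<eta> k"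
  show ?case
  proof (cases "fires_at d \<eta> k")
    case False
    then show ?thesis using l lo by (intro exI[of _ l]) (auto simp: le_SucI)
  next
    case True
    define z where "z = site_enum k"
    have n': "odo d \<eta> (Suc k) = n(z := Suc (n z))" using True by (auto simp: n_def z_def)
    have z: "2 * int d \<le> height d \<eta> n z" using True by (auto simp: fires_def n_def z_def)
    \<comment> \<open>All old labels are at most \<open>k\<close>, so \<open>Suc k\<close> is new
      and largest.\<close>
    define l' where "l' = l(z := Suc k)"
    have "inj_on l {x. 0 < n x}" using lo by (simp add: last_ordered_def n_def)
    moreover have "l y \<noteq> Suc k" for y using l[of y] by auto
    ultimately have inj: "inj_on l' {x. 0 < (n(z := Suc (n z))) x}"
      by (auto simp: inj_on_def l'_def) metis
    have "int (card {y \<in> nbrs x. 0 < (n(z := Suc (n z))) y \<and> l' x < l' y})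
        \<le> height d \<eta> (n(z := Suc (n z))) x" if x: "0 < (n(z := Suc (n z))) x" for x
    proof (cases "x = z")
      case True
      \<comment> \<open>The site that just toppled has no later neighbour, so it suffices that its
        height is still nonnegative.\<close>
      have "{y \<in> nbrs x. 0 < (n(z := Suc (n z))) y \<and> l' x < l' y} = {}"
        using True l by (auto simp: l'_def not_less le_SucI)
      moreover have "height d \<eta> (n(z := Suc (n z))) z = height d \<eta> n z - 2 * int d"
        by (auto simp: height_def algebra_simps intro!: sum.cong)
      ultimately show ?thesis using True z by (simp only:) simp
    next
      case False
      \<comment> \<open>Elsewhere only \<open>z\<close> can become a later neighbour, and when it
        does, \<open>x\<close> has just received a grain from it.\<close>
      have sub: "{y \<in> nbrs x. 0 < (n(z := Suc (n z))) y \<and> l' x < l' y}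
          \<subseteq> {y \<in> nbrs x. 0 < n y \<and> l x < l y} \<union> (if adj x z then {z} else {})"
        using False by (auto simp: l'_def split: if_splits)
      have "card {y \<in> nbrs x. 0 < (n(z := Suc (n z))) y \<and> l' x < l' y}
          \<le> card ({y \<in> nbrs x. 0 < n y \<and> l x < l y} \<union> (if adj x z then {z} else {}))"
        by (intro card_mono[OF _ sub]) (use finite_nbrs[of x] in \<open>auto simp del: in_nbrs\<close>)
      also have "\<dots> \<le> card {y \<in> nbrs x. 0 < n y \<and> l x < l y} + card (if adj x z then {z} else {})"
        by (rule card_Un_le)
      also have "card (if adj x z then {z} else {}) = of_bool (adj x z)" by simp
      finally have "card {y \<in> nbrs x. 0 < (n(z := Suc (n z))) y \<and> l' x < l' y}
          \<le> card {y \<in> nbrs x. 0 < n y \<and> l x < l y} + of_bool (adj x z)" .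
      from of_nat_mono[OF this, where 'a = int]
      have c: "int (card {y \<in> nbrs x. 0 < (n(z := Suc (n z))) y \<and> l' x < l' y})
          \<le> int (card {y \<in> nbrs x. 0 < n y \<and> l x < l y}) + of_bool (adj x z)"
        by (simp only: of_nat_add of_nat_of_bool)
      have "(\<Sum>y\<in>nbrs x. int ((n(z := Suc (n z))) y))
          = (\<Sum>y\<in>nbrs x. int (n y) + (if y = z then 1 else 0))"
        by (intro sum.cong) auto
      also have "\<dots> = (\<Sum>y\<in>nbrs x. int (n y)) + of_bool (adj x z)"
        by (simp add: sum.distrib)
      finally have h: "height d \<eta> (n(z := Suc (n z))) x = height d \<eta> n x + of_bool (adj x z)"
        using False by (simp add: height_def)
      have "int (card {y \<in> nbrs x. 0 < n y \<and> l x < l y}) \<le> height d \<eta> n x"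
        using lo x False by (auto simp: last_ordered_def n_def)
      then show ?thesis using c h by linarith
    qed
    then have "last_ordered d \<eta> (odo d \<eta> (Suc k)) l'"
      using inj unfolding last_ordered_def n' by blast
    moreover have "l' x \<le> Suc k" for x using l by (simp add: l'_def le_SucI)
    ultimately show ?thesis by blast
  qed
qed

text \<open>Conservation of grains: the initial mass of \<open>C\<close> is its present mass plus
  its net outflow. With \<open>R\<close> the inner edges, the present mass is at least
  \<open>card R\<close> and the outflow at least the number
  \<open>2 * d * card C - 2 * card R\<close> of boundary edges. The sum is at least
  \<open>d * card C\<close> since \<open>card R \<le> d * card C\<close>.\<close>

lemma toppled_mass:
  assumes C: "finite C" "C \<subseteq> greedy_toppled d \<eta> k"
    and closed: "\<And>x y. x \<in> C \<Longrightarrow> adj x y \<Longrightarrow> y \<in> greedy_toppled d \<eta> k \<Longrightarrow> y \<in> C"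
  shows "d * card C \<le> (\<Sum>x\<in>C. \<eta> x)"
proof -
  define n where "n = odo d \<eta> k"
  obtain l where lo: "last_ordered d \<eta> n l" using last_ordered_odo n_def by blast
  have pos: "0 < n x" if "x \<in> C" for x using C that by (auto simp: greedy_toppled_def n_def)
  have inC: "y \<in> C" if "x \<in> C" "adj x y" "0 < n y" for x y
    using closed that by (auto simp: greedy_toppled_def n_def)
  define deg where "deg x = card (nbrs x \<inter> C)" for x
  define up where "up x = card {y \<in> nbrs x. 0 < n y \<and> l x < l y}" for x
  have deg_le: "deg x \<le> 2 * d" if "x \<in> C" for x
  proof -
    have "deg x \<le> card (nbrs x)" unfolding deg_def by (intro card_mono) auto
    moreover have "length x = d" using that C greedy_toppled_subset by (fastforce simp: sites_def)
    ultimately show ?thesis using card_nbrs_le[of x] by simp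
  qed
  have inj: "inj_on l C" using lo pos by (auto simp: last_ordered_def inj_on_def)
  \<comment> \<open>Each inner edge occurs once, oriented by \<open>l\<close>.\<close>
  define R where "R = {(x, y). x \<in> C \<and> y \<in> C \<and> adj x y \<and> l x < l y}"
  have finR: "finite R" by (rule finite_subset[of _ "C \<times> C"]) (auto simp: R_def C)
  have up_sum: "(\<Sum>x\<in>C. up x) = card R"
  proof -
    have "R = (SIGMA x:C. {y \<in> nbrs x. 0 < n y \<and> l x < l y})"
      using pos inC by (auto simp: R_def)
    moreover have "finite {y \<in> nbrs x. 0 < n y \<and> l x < l y}" for x
      by (rule finite_subset[OF _ finite_nbrs]) auto
    ultimately show ?thesis
      using card_SigmaI[of C "\<lambda>x. {y \<in> nbrs x. 0 < n y \<and> l x < l y}"] C unfolding up_def by metis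
  qed
  have deg_sum: "(\<Sum>x\<in>C. deg x) = 2 * card R"
  proof -
    have "(SIGMA x:C. nbrs x \<inter> C) = R \<union> R\<inverse>"
    proof -
      have "l x < l y \<or> l y < l x" if "x \<in> C" "y \<in> C" "adj x y" for x y
        using that inj by (metis inj_onD linorder_neqE_nat not_adj_self)
      then show ?thesis unfolding R_def using adj_sym by (auto, blast)
    qed
    then have "(\<Sum>x\<in>C. deg x) = card (R \<union> R\<inverse>)" using C by (simp add: deg_def flip: card_SigmaI)
    also have "\<dots> = card R + card (R\<inverse>)"
      using finR by (intro card_Un_disjoint) (auto simp: R_def)
    finally show ?thesis by simp
  qed
  \<comment> \<open>Neighbours outside \<open>C\<close> have not toppled, so grains arriving in
    \<open>C\<close> come from \<open>C\<close>, and the double sum can be regrouped by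
    sender.\<close>
  have flow: "(\<Sum>x\<in>C. \<Sum>y\<in>nbrs x. int (n y)) = (\<Sum>x\<in>C. int (deg x) * int (n x))"
  proof -
    have "(\<Sum>x\<in>C. \<Sum>y\<in>nbrs x. int (n y)) = (\<Sum>x\<in>C. \<Sum>y | y \<in> C \<and> adj x y. int (n y))"
      using inC C by (intro sum.cong refl sum.mono_neutral_right) auto
    also have "\<dots> = (\<Sum>y\<in>C. \<Sum>x | x \<in> C \<and> adj x y. int (n y))"
      using C by (intro sum.swap_restrict) auto
    also have "\<dots> = (\<Sum>y\<in>C. int (deg y) * int (n y))"
    proof (intro sum.cong refl)
      fix y
      have "{x. x \<in> C \<and> adj x y} = nbrs y \<inter> C" by (auto simp: adj_sym)
      then show "(\<Sum>x | x \<in> C \<and> adj x y. int (n y)) = int (deg y) * int (n y)"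
        by (simp add: deg_def)
    qed
    finally show ?thesis .
  qed
  have "(\<Sum>x\<in>C. height d \<eta> n x)
      = (\<Sum>x\<in>C. int (\<eta> x)) + (\<Sum>x\<in>C. int (deg x) * int (n x)) - (\<Sum>x\<in>C. 2 * int d * int (n x))"
    unfolding flow[symmetric] by (simp add: height_def sum.distrib sum_subtractf)
  then have "(\<Sum>x\<in>C. int (\<eta> x))
      = (\<Sum>x\<in>C. height d \<eta> n x + (2 * int d - int (deg x)) * int (n x))"
    by (simp add: algebra_simps sum.distrib sum_subtractf)
  \<comment> \<open>Every site of \<open>C\<close> toppled at least once, so each of its
    \<open>2 * d - deg x\<close> missing edges accounts for at least one lost grain.\<close>
  also have "\<dots> \<ge> (\<Sum>x\<in>C. int (up x) + (2 * int d - int (deg x)))"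
  proof (intro sum_mono add_mono)
    fix x assume x: "x \<in> C"
    show "int (up x) \<le> height d \<eta> n x" using lo pos[OF x] by (auto simp: last_ordered_def up_def)
    have "(2 * int d - int (deg x)) * 1 \<le> (2 * int d - int (deg x)) * int (n x)"
      using deg_le[OF x] pos[OF x] by (intro mult_left_mono) auto
    then show "2 * int d - int (deg x) \<le> (2 * int d - int (deg x)) * int (n x)" by simp
  qed
  also have "(\<Sum>x\<in>C. int (up x) + (2 * int d - int (deg x)))
      = int (\<Sum>x\<in>C. up x) + 2 * int d * int (card C) - int (\<Sum>x\<in>C. deg x)"
    by (simp add: sum.distrib sum_subtractf algebra_simps)
  also have "\<dots> = 2 * int d * int (card C) - int (card R)"
    unfolding up_sum deg_sum by simp
  finally have "2 * int (d * card C) \<le> int (\<Sum>x\<in>C. \<eta> x) + int (card R)" by simp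
  moreover have "card R \<le> d * card C"
  proof -
    have "(\<Sum>x\<in>C. deg x) \<le> (\<Sum>x\<in>C. 2 * d)" by (intro sum_mono deg_le)
    also have "\<dots> = 2 * (d * card C)" by simp
    finally show ?thesis unfolding deg_sum by simp
  qed
  ultimately show ?thesis by linarith
qed

section \<open>Components of increasing sets\<close>

lemma origin_component_mono: "S \<subseteq> S' \<Longrightarrow> origin_component d S \<subseteq> origin_component d S'"
proof
  fix y assume S: "S \<subseteq> S'" and "y \<in> origin_component d S"
  then have "origin d \<in> S" "(\<lambda>a b. a \<in> S \<and> b \<in> S \<and> adj a b)\<^sup>*\<^sup>* (origin d) y"
    by (auto simp: origin_component_def)
  moreover from this(2) have "(\<lambda>a b. a \<in> S' \<and> b \<in> S' \<and> adj a b)\<^sup>*\<^sup>* (origin d) y"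
    by (rule rtranclp_mono[THEN predicate2D, rotated]) (use S in auto)
  ultimately show "y \<in> origin_component d S'" using S by (auto simp: origin_component_def)
qed

lemma origin_component_subset: "origin_component d S \<subseteq> S"
proof
  fix y assume "y \<in> origin_component d S"
  then have "origin d \<in> S" "(\<lambda>a b. a \<in> S \<and> b \<in> S \<and> adj a b)\<^sup>*\<^sup>* (origin d) y"
    by (auto simp: origin_component_def)
  from this(2,1) show "y \<in> S" by (induction) auto
qed

lemma origin_component_closed:
  "x \<in> origin_component d S \<Longrightarrow> adj x y \<Longrightarrow> y \<in> S \<Longrightarrow> y \<in> origin_component d S"
proof -
  assume x: "x \<in> origin_component d S" and y: "adj x y" "y \<in> S"
  have "x \<in> S" using x origin_component_subset by blast
  then show ?thesis
    using x y by (auto simp: origin_component_def elim!: rtranclp.rtrancl_into_rtrancl)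
qed

text \<open>A path is finite, so by induction along it all its sites lie in a common stage.\<close>

lemma origin_component_UN:
  assumes mono: "\<And>k l. k \<le> l \<Longrightarrow> S k \<subseteq> S l"
  shows "origin_component d (\<Union>k::nat. S k) = (\<Union>k. origin_component d (S k))"
proof
  show "(\<Union>k. origin_component d (S k)) \<subseteq> origin_component d (\<Union>k. S k)"
    by (intro UN_least origin_component_mono) auto
  show "origin_component d (\<Union>k. S k) \<subseteq> (\<Union>k. origin_component d (S k))"
  proof
    fix y assume "y \<in> origin_component d (\<Union>k. S k)"
    then obtain k0 where k0: "origin d \<in> S k0"
      and "(\<lambda>a b. a \<in> (\<Union>k. S k) \<and> b \<in> (\<Union>k. S k) \<and> adj a b)\<^sup>*\<^sup>* (origin d) y"
      by (auto simp: origin_component_def)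
    from this(2) show "y \<in> (\<Union>k. origin_component d (S k))"
    proof induction
      case base
      then show ?case using k0 by (auto simp: origin_component_def)
    next
      case (step y z)
      then obtain k1 k2 where "y \<in> origin_component d (S k1)" "z \<in> S k2" "adj y z" by blast
      then have "y \<in> origin_component d (S (max k1 k2))" "z \<in> S (max k1 k2)"
        using origin_component_mono mono by (meson max.cobounded1 max.cobounded2 subsetD)+
      then show ?case using origin_component_closed \<open>adj y z\<close> by blast
    qed
  qed
qed

text \<open>If the union is infinite or has at least \<open>n\<close> elements, some
  \<open>n\<close> of them already lie in one stage. This turns the size condition of the event,
  infinite clusters included, into a countable union.\<close>

lemma card_increasing_UN:
  fixes F :: "nat \<Rightarrow> 'a set"
  assumes mono: "\<And>k l. k \<le> l \<Longrightarrow> F k \<subseteq> F l" and fin: "\<And>k. finite (F k)"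
  shows "\<not> (finite (\<Union>k. F k) \<and> card (\<Union>k. F k) < n) \<longleftrightarrow> (\<exists>k. n \<le> card (F k))"
proof
  assume "\<not> (finite (\<Union>k. F k) \<and> card (\<Union>k. F k) < n)"
  then obtain A where A: "A \<subseteq> (\<Union>k. F k)" "finite A" "card A = n"
    by (metis infinite_arbitrarily_large not_less obtain_subset_with_card_n)
  have "\<forall>x\<in>A. \<exists>k. x \<in> F k" using A by auto
  then obtain k where k: "\<And>x. x \<in> A \<Longrightarrow> x \<in> F (k x)" by metis
  obtain K where "k ` A \<subseteq> {..K}" using A(2) finite_nat_iff_bounded_le by blast
  then have "A \<subseteq> F K" using k mono by blast
  then show "\<exists>k. n \<le> card (F k)" using A fin card_mono by metis
next
  assume "\<exists>k. n \<le> card (F k)"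
  then obtain k where k: "n \<le> card (F k)" by blast
  have "card (F k) \<le> card (\<Union>k. F k)" if "finite (\<Union>k. F k)"
    by (rule card_mono[OF that]) auto
  then show "\<not> (finite (\<Union>k. F k) \<and> card (\<Union>k. F k) < n)" using k by linarith
qed

definition greedy_cluster :: "nat \<Rightarrow> (int list \<Rightarrow> nat) \<Rightarrow> nat \<Rightarrow> int list set" where
  "greedy_cluster d \<eta> k = origin_component d (greedy_toppled d \<eta> k)"

lemma finite_greedy_cluster [simp]: "finite (greedy_cluster d \<eta> k)"
  unfolding greedy_cluster_def using origin_component_subset finite_greedy_toppled finite_subset by blast

lemma big_cluster_event_eq:
  "big_cluster_event d p n =
     {\<eta> \<in> space (sandpile_measure d p). greedy_bounded d \<eta> \<and> (\<exists>k. n \<le> card (greedy_cluster d \<eta> k))}"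
proof -
  have "\<not> (finite (origin_component d (toppled d \<eta>)) \<and> card (origin_component d (toppled d \<eta>)) < n)
      \<longleftrightarrow> (\<exists>k. n \<le> card (greedy_cluster d \<eta> k))" if "stabilizable d \<eta>" for \<eta>
  proof -
    have "origin_component d (toppled d \<eta>) = (\<Union>k. greedy_cluster d \<eta> k)"
      unfolding greedy_cluster_def toppled_eq[OF that]
      by (rule origin_component_UN) (rule greedy_toppled_mono)
    then show ?thesis
      using card_increasing_UN[of "greedy_cluster d \<eta>" n]
      by (simp add: greedy_cluster_def origin_component_mono greedy_toppled_mono del: finite_UN)
        (simp add: greedy_cluster_def[symmetric] del: finite_UN)
  qed
  then show ?thesis unfolding big_cluster_event_def stabilizable_iff[symmetric] by blast
qed

section \<open>Measurability of the cluster event\<close>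

lemma measurable_coordinate:
  assumes "x \<in> sites d"
  shows "(\<lambda>\<eta>. f (\<eta> x)) \<in> measurable (sandpile_measure d p) (count_space UNIV)"
proof -
  have "(\<lambda>\<eta>. \<eta> x) \<in> measurable (sandpile_measure d p) (measure_pmf p)"
    unfolding sandpile_measure_def by (rule measurable_component_singleton[OF assms])
  from measurable_compose[OF this, of f "count_space UNIV"] show ?thesis by simp
qed

lemma measurable_odo [measurable]:
  "(\<lambda>\<eta>. odo d \<eta> k x) \<in> measurable (sandpile_measure d p) (count_space UNIV)"
proof (induction k arbitrary: x)
  case (Suc k)
  note [measurable] = Suc
  show ?case
  proof (cases "site_enum k \<in> sites d")
    case True
    let ?z = "site_enum k"
    have [measurable]: "(\<lambda>\<eta>. real (odo d \<eta> k z)) \<in> borel_measurable (sandpile_measure d p)" for z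
      using measurable_compose[OF Suc, of real borel] by simp
    have [measurable]: "(\<lambda>\<eta>. real (\<eta> ?z)) \<in> borel_measurable (sandpile_measure d p)"
      using measurable_compose[OF measurable_coordinate[OF True, of "\<lambda>k. k"], of real borel] by simp
    \<comment> \<open>The integer test is moved to the reals, where sums and comparisons are Borel
      measurable.\<close>
    have unstable_iff: "2 * int d \<le> height d \<eta> n z \<longleftrightarrow>
        2 * real d \<le> real (\<eta> z) + (\<Sum>y\<in>nbrs z. real (n y)) - 2 * real d * real (n z)" for \<eta> n z
    proof -
      have "2 * int d \<le> height d \<eta> n z \<longleftrightarrow> real_of_int (2 * int d) \<le> real_of_int (height d \<eta> n z)"
        by (simp only: of_int_le_iff)
      then show ?thesis by (simp add: height_def)
    qed
    have "Measurable.pred (sandpile_measure d p) (\<lambda>\<eta>. fires_at d \<eta> k)"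
      unfolding fires_def unstable_iff by measurable
    then have "Measurable.pred (sandpile_measure d p) (\<lambda>\<eta>. site_enum k = x \<and> fires_at d \<eta> k)"
      by (cases "site_enum k = x") simp_all
    note fire = predE[OF this]
    have eq: "(\<lambda>\<eta>. odo d \<eta> (Suc k) x)
        = (\<lambda>\<eta>. if site_enum k = x \<and> fires_at d \<eta> k then Suc (odo d \<eta> k x) else odo d \<eta> k x)"
      by auto
    have "(\<lambda>\<eta>. Suc (odo d \<eta> k x)) \<in> measurable (sandpile_measure d p) (count_space UNIV)"
      using measurable_compose[OF Suc, of Suc "count_space UNIV"] by simp
    from measurable_If[OF this Suc fire] show ?thesis unfolding eq .
  qed (simp add: fires_def)
qed simp

text \<open>After \<open>k\<close> steps the toppled set is one of finitely many subsets of the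
  visited sites, and it determines the cluster.\<close>

lemma pred_greedy_cluster [measurable]:
  "Measurable.pred (sandpile_measure d p) (\<lambda>\<eta>. n \<le> card (greedy_cluster d \<eta> k))"
proof -
  let ?U = "Pow (site_enum ` {..<k})"
  have "n \<le> card (greedy_cluster d \<eta> k) \<longleftrightarrow>
      (\<exists>F\<in>{F \<in> ?U. n \<le> card (origin_component d F)}. \<forall>x. 0 < odo d \<eta> k x \<longleftrightarrow> x \<in> F)" for \<eta>
  proof
    assume "n \<le> card (greedy_cluster d \<eta> k)"
    then show "\<exists>F\<in>{F \<in> ?U. n \<le> card (origin_component d F)}. \<forall>x. 0 < odo d \<eta> k x \<longleftrightarrow> x \<in> F"
      using greedy_toppled_subset[of d \<eta> k]
      by (intro bexI[of _ "greedy_toppled d \<eta> k"]) (auto simp: greedy_cluster_def greedy_toppled_def)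
  next
    assume "\<exists>F\<in>{F \<in> ?U. n \<le> card (origin_component d F)}. \<forall>x. 0 < odo d \<eta> k x \<longleftrightarrow> x \<in> F"
    then obtain F where "n \<le> card (origin_component d F)" "F = greedy_toppled d \<eta> k"
      by (auto simp: greedy_toppled_def)
    then show "n \<le> card (greedy_cluster d \<eta> k)" by (simp add: greedy_cluster_def)
  qed
  moreover have "Measurable.pred (sandpile_measure d p)
      (\<lambda>\<eta>. \<exists>F\<in>{F \<in> ?U. n \<le> card (origin_component d F)}. \<forall>x. 0 < odo d \<eta> k x \<longleftrightarrow> x \<in> F)"
    by (intro pred_intros_finite) (auto intro!: finite_subset[of _ ?U])
  ultimately show ?thesis by (simp only:)
qed

lemma big_cluster_event_measurable: "big_cluster_event d p n \<in> sets (sandpile_measure d p)"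
  unfolding big_cluster_event_eq greedy_bounded_def by measurable

section \<open>Union bound over heavy clusters\<close>

lemma prob_space_sandpile: "prob_space (sandpile_measure d p)"
  unfolding sandpile_measure_def by (intro prob_space_PiM measure_pmf.prob_space_axioms)

lemma borel_measurable_coordinate:
  assumes "x \<in> sites d"
  shows "(\<lambda>\<eta>. f (\<eta> x)) \<in> borel_measurable (sandpile_measure d p)"
  using measurable_compose[OF measurable_coordinate[OF assms, of "\<lambda>k. k"], of f borel] by simp

lemma nn_integral_sandpile_prod:
  assumes J: "finite J" "J \<subseteq> sites d"
  shows "(\<integral>\<^sup>+\<eta>. (\<Prod>x\<in>J. f x (\<eta> x)) \<partial>sandpile_measure d p) = (\<Prod>x\<in>J. \<integral>\<^sup>+k. f x k \<partial>measure_pmf p)"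
proof -
  interpret product_prob_space "\<lambda>_. measure_pmf p" "sites d"
    by (intro product_prob_spaceI measure_pmf.prob_space_axioms)
  let ?I = "PiM (sites d) (\<lambda>_. measure_pmf p)" and ?J = "PiM J (\<lambda>_. measure_pmf p)"
  have "(\<Prod>x\<in>J. \<integral>\<^sup>+k. f x k \<partial>measure_pmf p) = (\<integral>\<^sup>+\<omega>. (\<Prod>x\<in>J. f x (\<omega> x)) \<partial>?J)"
    by (rule product_nn_integral_prod[symmetric]) (use J in auto)
  also have "\<dots> = (\<integral>\<^sup>+\<omega>. (\<Prod>x\<in>J. f x (\<omega> x)) \<partial>distr ?I ?J (\<lambda>\<eta>. restrict \<eta> J))"
    by (simp add: distr_PiM_restrict_finite J)
  also have "\<dots> = (\<integral>\<^sup>+\<eta>. (\<Prod>x\<in>J. f x (restrict \<eta> J x)) \<partial>?I)"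
  proof -
    have 1: "(\<lambda>\<eta>. restrict \<eta> J) \<in> measurable ?I ?J" using J by (intro measurable_restrict_subset)
    have "(\<lambda>\<omega>. f x (\<omega> x)) \<in> borel_measurable ?J" if "x \<in> J" for x
      using measurable_compose[OF measurable_component_singleton[OF that, of "\<lambda>_. measure_pmf p"], of "f x" borel]
      by simp
    then have "(\<lambda>\<omega>. \<Prod>x\<in>J. f x (\<omega> x)) \<in> borel_measurable ?J"
      by (intro borel_measurable_prod_ennreal)
    then have 2: "(\<lambda>\<omega>. \<Prod>x\<in>J. f x (\<omega> x)) \<in> borel_measurable (distr ?I ?J (\<lambda>\<eta>. restrict \<eta> J))"
      by simp
    from nn_integral_distr[OF 1 2] show ?thesis .
  qed
  also have "\<dots> = (\<integral>\<^sup>+\<eta>. (\<Prod>x\<in>J. f x (\<eta> x)) \<partial>?I)"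
    by (intro nn_integral_cong prod.cong) auto
  finally show ?thesis by (simp add: sandpile_measure_def)
qed

lemma mgf_ge_1:
  assumes "integrable (measure_pmf p) (\<lambda>k. exp (t * real k))" "0 \<le> t"
  shows "1 \<le> mgf p t"
proof -
  have "measure_pmf.expectation p (\<lambda>_. 1) \<le> mgf p t"
    unfolding mgf_def using assms by (intro integral_mono) auto
  then show ?thesis by simp
qed

lemma sets_vanishing_heavy:
  assumes "finite W" "W \<subseteq> sites d" "finite C" "C \<subseteq> sites d"
  shows "{\<eta> \<in> space (sandpile_measure d p). (\<forall>x\<in>W. \<eta> x = 0) \<and> a \<le> (\<Sum>x\<in>C. \<eta> x)}
    \<in> sets (sandpile_measure d p)"
proof -
  have "Measurable.pred (sandpile_measure d p) (\<lambda>\<eta>. \<forall>x\<in>W. \<eta> x = 0)"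
    using assms by (intro pred_intros_finite measurable_coordinate[where f = "\<lambda>k. k = 0"]) auto
  moreover have "Measurable.pred (sandpile_measure d p) (\<lambda>\<eta>. a \<le> (\<Sum>x\<in>C. \<eta> x))"
  proof -
    have [measurable]: "(\<lambda>\<eta>. \<Sum>x\<in>C. real (\<eta> x)) \<in> borel_measurable (sandpile_measure d p)"
      using assms by (intro borel_measurable_sum borel_measurable_coordinate) auto
    have "a \<le> (\<Sum>x\<in>C. \<eta> x) \<longleftrightarrow> real a \<le> (\<Sum>x\<in>C. real (\<eta> x))" for \<eta>
      by (simp flip: of_nat_sum)
    then show ?thesis by simp
  qed
  ultimately show ?thesis by measurable
qed

text \<open>Chernoff bound with the vanishing condition kept as an exact factor: sites of
  \<open>W\<close> contribute \<open>pmf p 0\<close>, and only those of \<open>C - W\<close> need an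
  exponential moment. The moment is at least one, so \<open>C - W\<close> may be enlarged to
  \<open>C\<close>.\<close>

lemma prob_vanishing_heavy_le:
  assumes W: "finite W" "W \<subseteq> sites d" and C: "finite C" "C \<subseteq> sites d"
    and int: "integrable (measure_pmf p) (\<lambda>k. exp (t * real k))" and t: "0 \<le> t"
  shows "measure (sandpile_measure d p)
      {\<eta> \<in> space (sandpile_measure d p). (\<forall>x\<in>W. \<eta> x = 0) \<and> a \<le> (\<Sum>x\<in>C. \<eta> x)}
    \<le> pmf p 0 ^ card W * (mgf p t ^ card C * exp (- t * real a))"
proof -
  interpret prob_space "sandpile_measure d p" by (rule prob_space_sandpile)
  let ?M = "sandpile_measure d p"
  let ?A = "{\<eta> \<in> space ?M. (\<forall>x\<in>W. \<eta> x = 0) \<and> a \<le> (\<Sum>x\<in>C. \<eta> x)}"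
  define f where "f x k = (if x \<in> W then indicator {0} k else ennreal (exp (t * real k)))"
    for x :: "int list" and k :: nat
  have fint: "(\<integral>\<^sup>+k. f x k \<partial>measure_pmf p) = (if x \<in> W then ennreal (pmf p 0) else ennreal (mgf p t))" for x
    using nn_integral_eq_integral[OF int] by (simp add: f_def mgf_def emeasure_pmf_single)
  have "emeasure ?M ?A = (\<integral>\<^sup>+\<eta>. indicator ?A \<eta> \<partial>?M)"
    using sets_vanishing_heavy[OF W C] by simp
  also have "\<dots> \<le> (\<integral>\<^sup>+\<eta>. ennreal (exp (- t * real a)) * (\<Prod>x\<in>W \<union> C. f x (\<eta> x)) \<partial>?M)"
  proof (intro nn_integral_mono)
    fix \<eta>
    show "indicator ?A \<eta> \<le> ennreal (exp (- t * real a)) * (\<Prod>x\<in>W \<union> C. f x (\<eta> x))"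
    proof (cases "\<eta> \<in> ?A")
      case True
      then have zero: "\<And>x. x \<in> W \<Longrightarrow> \<eta> x = 0" and sum: "a \<le> (\<Sum>x\<in>C. \<eta> x)" by auto
      \<comment> \<open>On the event both weights agree on \<open>W\<close>, since the exponential
        of zero is one.\<close>
      have "(\<Prod>x\<in>W \<union> C. f x (\<eta> x)) = (\<Prod>x\<in>W \<union> C. ennreal (exp (t * real (\<eta> x))))"
        using zero by (intro prod.cong) (auto simp: f_def)
      also have "\<dots> = ennreal (exp (\<Sum>x\<in>W \<union> C. t * real (\<eta> x)))"
        using W C by (simp add: exp_sum prod_ennreal)
      also have "(\<Sum>x\<in>W \<union> C. t * real (\<eta> x)) = (\<Sum>x\<in>C. t * real (\<eta> x))"
        using W C zero by (intro sum.mono_neutral_right) auto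
      finally have "ennreal (exp (- t * real a)) * (\<Prod>x\<in>W \<union> C. f x (\<eta> x))
          = ennreal (exp (t * real (\<Sum>x\<in>C. \<eta> x) - t * real a))"
        by (simp add: sum_distrib_left exp_diff exp_minus field_simps flip: ennreal_mult)
      moreover have "t * real a \<le> t * real (\<Sum>x\<in>C. \<eta> x)"
        using sum t by (intro mult_left_mono) (simp_all only: of_nat_le_iff)
      ultimately show ?thesis using True by (simp del: of_nat_sum)
    qed simp
  qed
  also have "\<dots> = ennreal (exp (- t * real a)) * (\<integral>\<^sup>+\<eta>. (\<Prod>x\<in>W \<union> C. f x (\<eta> x)) \<partial>?M)"
    using W C by (intro nn_integral_cmult borel_measurable_prod_ennreal borel_measurable_coordinate) auto
  also have "(\<integral>\<^sup>+\<eta>. (\<Prod>x\<in>W \<union> C. f x (\<eta> x)) \<partial>?M)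
      = (\<Prod>x\<in>W \<union> C. if x \<in> W then ennreal (pmf p 0) else ennreal (mgf p t))"
    using W C by (subst nn_integral_sandpile_prod) (auto simp: fint)
  also have "\<dots> = (\<Prod>x\<in>W. ennreal (pmf p 0)) * (\<Prod>x\<in>C - W. ennreal (mgf p t))"
  proof -
    have "W \<union> C = W \<union> (C - W)" by auto
    then show ?thesis using W C by (simp add: prod.union_disjoint del: Un_Diff_cancel)
  qed
  also have "\<dots> = ennreal (pmf p 0 ^ card W * mgf p t ^ card (C - W))"
    using mgf_ge_1[OF int t] by (simp add: ennreal_power flip: ennreal_mult)
  finally have "emeasure ?M ?A
      \<le> ennreal (exp (- t * real a) * (pmf p 0 ^ card W * mgf p t ^ card (C - W)))"
    using mgf_ge_1[OF int t] by (simp flip: ennreal_mult)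
  then have "prob ?A \<le> exp (- t * real a) * (pmf p 0 ^ card W * mgf p t ^ card (C - W))"
    using mgf_ge_1[OF int t] by (simp add: emeasure_eq_measure)
  also have "\<dots> \<le> exp (- t * real a) * (pmf p 0 ^ card W * mgf p t ^ card C)"
    using mgf_ge_1[OF int t] C by (intro mult_left_mono power_increasing card_mono) auto
  finally show ?thesis by (simp add: mult_ac)
qed

lemma prob_vanishing:
  assumes W: "finite W" "W \<subseteq> sites d"
  shows "measure (sandpile_measure d p) {\<eta> \<in> space (sandpile_measure d p). \<forall>x\<in>W. \<eta> x = 0}
    = pmf p 0 ^ card W"
proof -
  interpret prob_space "sandpile_measure d p" by (rule prob_space_sandpile)
  let ?M = "sandpile_measure d p"
  let ?A = "{\<eta> \<in> space ?M. \<forall>x\<in>W. \<eta> x = 0}"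
  have "?A \<in> sets ?M" using sets_vanishing_heavy[OF W, of "{}" p 0] by simp
  then have "emeasure ?M ?A = (\<integral>\<^sup>+\<eta>. indicator ?A \<eta> \<partial>?M)" by simp
  also have "\<dots> = (\<integral>\<^sup>+\<eta>. (\<Prod>x\<in>W. indicator {0} (\<eta> x)) \<partial>?M)"
  proof (intro nn_integral_cong)
    fix \<eta> assume "\<eta> \<in> space ?M"
    then show "indicator ?A \<eta> = (\<Prod>x\<in>W. indicator {0} (\<eta> x) :: ennreal)"
      using W by (cases "\<forall>x\<in>W. \<eta> x = 0") (auto intro!: prod_zero[symmetric] simp: indicator_def)
  qed
  also have "\<dots> = ennreal (pmf p 0 ^ card W)"
    using W by (subst nn_integral_sandpile_prod) (auto simp: emeasure_pmf_single ennreal_power)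
  finally show ?thesis by (simp add: emeasure_eq_measure)
qed

lemma (in prob_space) prob_union_tail_le:
  assumes ev: "\<And>m. A m \<in> events" and bound: "\<And>m. prob (A m) \<le> B * s ^ m"
    and s: "0 \<le> s" "s < 1"
  shows "prob (\<Union>m\<in>{n..}. A m) \<le> B * s ^ n / (1 - s)"
proof -
  have sums: "(\<lambda>m. B * s ^ (m + n)) sums (B * s ^ n / (1 - s))"
    using sums_mult[OF geometric_sums[of s], of "B * s ^ n"] s by (simp add: power_add mult_ac)
  have summ: "summable (\<lambda>m. prob (A (m + n)))"
    using bound by (intro summable_comparison_test'[OF sums_summable[OF sums], of 0]) auto
  have "(\<Union>m\<in>{n..}. A m) = (\<Union>m. A (m + n))"
  proof -
    have "{n..} = range (\<lambda>m. m + n)" by (auto simp: image_iff) (metis le_add_diff_inverse2)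
    then show ?thesis by (simp only: image_image)
  qed
  then have "prob (\<Union>m\<in>{n..}. A m) \<le> (\<Sum>m. prob (A (m + n)))"
    using finite_measure_subadditive_countably[of "\<lambda>m. A (m + n)"] ev summ by auto
  also have "\<dots> \<le> (\<Sum>m. B * s ^ (m + n))"
    by (intro suminf_le bound summ sums_summable[OF sums])
  finally show ?thesis using sums_unique[OF sums] by simp
qed

text \<open>Shapes are encoded as origin components of finite sets, the form in which greedy
  clusters arise; the only shape of size zero is the empty set.\<close>

definition cluster_shapes :: "nat \<Rightarrow> nat \<Rightarrow> int list set set" where
  "cluster_shapes d m =
     {C. card C = m \<and> (\<exists>F. finite F \<and> F \<subseteq> sites d \<and> C = origin_component d F)}"

text \<open>\<open>W\<close> is a window on which the configuration is forced to vanish. It is empty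
  for the tail bounds and an interval around the origin in one dimension.\<close>

definition heavy_event :: "nat \<Rightarrow> nat pmf \<Rightarrow> int list set \<Rightarrow> nat \<Rightarrow> (int list \<Rightarrow> nat) set" where
  "heavy_event d p W m = (\<Union>C\<in>cluster_shapes d m.
     {\<eta> \<in> space (sandpile_measure d p). (\<forall>x\<in>W. \<eta> x = 0) \<and> d * m \<le> (\<Sum>x\<in>C. \<eta> x)})"

lemma cluster_shapesD:
  assumes "C \<in> cluster_shapes d m"
  shows "finite C" "C \<subseteq> sites d" "card C = m"
proof -
  obtain F where F: "finite F" "F \<subseteq> sites d" "C = origin_component d F" and "card C = m"
    using assms by (auto simp: cluster_shapes_def)
  then show "finite C" "C \<subseteq> sites d" "card C = m"
    using origin_component_subset[of d F] finite_subset by auto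
qed

text \<open>At a stage where the greedy cluster has reached size \<open>n\<close> it is a whole
  component of the toppled set, so the mass bound applies to it. One step may join several pieces,
  hence the union over all sizes from \<open>n\<close> on.\<close>

lemma big_cluster_event_subset:
  "big_cluster_event d p n \<subseteq> (\<Union>m\<in>{n..}. heavy_event d p {} m)"
proof
  fix \<eta> assume "\<eta> \<in> big_cluster_event d p n"
  then obtain k where sp: "\<eta> \<in> space (sandpile_measure d p)" and k: "n \<le> card (greedy_cluster d \<eta> k)"
    by (auto simp: big_cluster_event_eq)
  let ?C = "greedy_cluster d \<eta> k"
  have "?C \<in> cluster_shapes d (card ?C)"
    unfolding cluster_shapes_def greedy_cluster_def
    using greedy_toppled_subset[of d \<eta> k]
    by (intro CollectI conjI refl exI[of _ "greedy_toppled d \<eta> k"]) simp_all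
  moreover have "d * card ?C \<le> (\<Sum>x\<in>?C. \<eta> x)"
  proof (rule toppled_mass)
    show "?C \<subseteq> greedy_toppled d \<eta> k"
      unfolding greedy_cluster_def by (rule origin_component_subset)
    show "y \<in> ?C" if "x \<in> ?C" "adj x y" "y \<in> greedy_toppled d \<eta> k" for x y
      using that unfolding greedy_cluster_def by (rule origin_component_closed)
  qed simp
  ultimately have "\<eta> \<in> heavy_event d p {} (card ?C)" using sp by (auto simp: heavy_event_def)
  then show "\<eta> \<in> (\<Union>m\<in>{n..}. heavy_event d p {} m)" using k by auto
qed

lemma sets_heavy_event:
  assumes "finite W" "W \<subseteq> sites d" "finite (cluster_shapes d m)"
  shows "heavy_event d p W m \<in> sets (sandpile_measure d p)"
  unfolding heavy_event_def
  by (intro sets.finite_UN sets_vanishing_heavy assms) (auto dest: cluster_shapesD)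

text \<open>The number of shapes enters only through \<open>B\<close> and \<open>s\<close>, so a
  linear count and an exponential count are treated alike.\<close>

lemma prob_heavy_tail_le:
  assumes W: "finite W" "W \<subseteq> sites d"
    and int: "integrable (measure_pmf p) (\<lambda>k. exp (t * real k))" and t: "0 \<le> t"
    and shapes: "\<And>m. finite (cluster_shapes d m)"
      "\<And>m. real (card (cluster_shapes d m)) * (mgf p t * exp (- t * real d)) ^ m \<le> B * s ^ m"
    and s: "0 \<le> s" "s < 1"
  shows "measure (sandpile_measure d p) (\<Union>m\<in>{n..}. heavy_event d p W m)
    \<le> pmf p 0 ^ card W * B * s ^ n / (1 - s)"
proof -
  interpret prob_space "sandpile_measure d p" by (rule prob_space_sandpile)
  let ?A = "\<lambda>m C. {\<eta> \<in> space (sandpile_measure d p). (\<forall>x\<in>W. \<eta> x = 0) \<and> d * m \<le> (\<Sum>x\<in>C. \<eta> x)}"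
  have "prob (heavy_event d p W m) \<le> pmf p 0 ^ card W * B * s ^ m" for m
  proof -
    let ?q = "mgf p t * exp (- t * real d)"
    have "prob (heavy_event d p W m) \<le> (\<Sum>C\<in>cluster_shapes d m. prob (?A m C))"
      unfolding heavy_event_def
      using cluster_shapesD[of _ d m]
      by (intro finite_measure_subadditive_finite shapes image_subsetI sets_vanishing_heavy W)
    also have "\<dots> \<le> (\<Sum>C\<in>cluster_shapes d m. pmf p 0 ^ card W * ?q ^ m)"
    proof (intro sum_mono)
      fix C assume C: "C \<in> cluster_shapes d m"
      have "prob (?A m C) \<le> pmf p 0 ^ card W * (mgf p t ^ card C * exp (- t * real (d * m)))"
        by (intro prob_vanishing_heavy_le W int t) (use cluster_shapesD[OF C] in auto)
      also have "mgf p t ^ card C * exp (- t * real (d * m)) = ?q ^ m"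
        using cluster_shapesD(3)[OF C]
        by (simp add: power_mult_distrib mult_ac flip: exp_of_nat_mult)
      finally show "prob (?A m C) \<le> pmf p 0 ^ card W * ?q ^ m" .
    qed
    also have "\<dots> = pmf p 0 ^ card W * (real (card (cluster_shapes d m)) * ?q ^ m)" by simp
    also have "\<dots> \<le> pmf p 0 ^ card W * (B * s ^ m)"
      by (intro mult_left_mono shapes) auto
    finally show ?thesis by (simp add: mult_ac)
  qed
  then show ?thesis
    by (intro prob_union_tail_le sets_heavy_event W shapes s)
qed

section \<open>Counting cluster shapes\<close>

definition walks :: "int list \<Rightarrow> nat \<Rightarrow> int list list set" where
  "walks x j = {w. length w = Suc j \<and> hd w = x \<and> successively adj w}"

lemma walks_Suc: "walks x (Suc j) = (\<Union>y\<in>nbrs x. (#) x ` walks y j)"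
proof (intro equalityI subsetI)
  fix w assume w: "w \<in> walks x (Suc j)"
  then obtain v where v: "w = x # v" "length v = Suc j" "successively adj w"
    by (cases w) (auto simp: walks_def)
  then have "v \<in> walks (hd v) j" "hd v \<in> nbrs x"
    by (cases v; auto simp: walks_def)+
  then show "w \<in> (\<Union>y\<in>nbrs x. (#) x ` walks y j)" using v by blast
next
  fix w assume "w \<in> (\<Union>y\<in>nbrs x. (#) x ` walks y j)"
  then obtain y v where "adj x y" "w = x # v" "v \<in> walks y j" by auto
  then show "w \<in> walks x (Suc j)" by (cases v) (auto simp: walks_def)
qed

lemma walks_card_le:
  assumes "x \<in> sites d"
  shows "finite (walks x j) \<and> card (walks x j) \<le> (2 * d) ^ j"
  using assms
proof (induction j arbitrary: x)
  case 0
  have "walks x 0 = {[x]}" by (auto simp: walks_def length_Suc_conv)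
  then show ?case by simp
next
  case (Suc j)
  have IH: "finite (walks y j)" "card (walks y j) \<le> (2 * d) ^ j" if "y \<in> nbrs x" for y
    using Suc.IH[of y] Suc.prems adj_sites[of x y d] that by auto
  have "card (walks x (Suc j)) \<le> (\<Sum>y\<in>nbrs x. card ((#) x ` walks y j))"
    unfolding walks_Suc by (rule card_UN_le) simp
  also have "\<dots> \<le> (\<Sum>y\<in>nbrs x. (2 * d) ^ j)"
    using IH by (intro sum_mono le_trans[OF card_image_le]) auto
  also have "\<dots> \<le> 2 * d * (2 * d) ^ j"
    using card_nbrs_le[of x] Suc.prems by (simp add: sites_def)
  finally show ?case
    unfolding walks_Suc using IH by (auto simp del: in_nbrs)
qed

text \<open>A path from the origin to a missing site has to leave \<open>A\<close> by some
  edge.\<close>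

lemma origin_component_escape:
  assumes "A \<subseteq> origin_component d F" "origin d \<in> A" "A \<noteq> origin_component d F"
  shows "\<exists>x\<in>A. \<exists>y\<in>origin_component d F - A. adj x y"
proof (rule ccontr)
  assume no: "\<not> ?thesis"
  have "z \<in> A" if "z \<in> origin_component d F" for z
  proof -
    from that have "(\<lambda>a b. a \<in> F \<and> b \<in> F \<and> adj a b)\<^sup>*\<^sup>* (origin d) z"
      by (simp add: origin_component_def)
    then show ?thesis
    proof induction
      case (step y z)
      then have "z \<in> origin_component d F" using assms(1) origin_component_closed by blast
      then show ?case using step no by blast
    qed (use assms in simp)
  qed
  then show False using assms by blast
qed

text \<open>The walk goes around a spanning tree; a new leaf \<open>y\<close> is attached by a detour
  \<open>x, y, x\<close>.\<close>
lemma origin_component_walk: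
  assumes "finite (origin_component d F)" "Suc j \<le> card (origin_component d F)"
  shows "\<exists>w\<in>walks (origin d) (2 * j). set w \<subseteq> origin_component d F \<and> card (set w) = Suc j"
  using assms
proof (induction j)
  case 0
  then have "origin_component d F \<noteq> {}" by auto
  then have "origin d \<in> origin_component d F" by (auto simp: origin_component_def)
  then show ?case by (intro bexI[of _ "[origin d]"]) (auto simp: walks_def)
next
  case (Suc j)
  let ?C = "origin_component d F"
  obtain w where w: "w \<in> walks (origin d) (2 * j)" "set w \<subseteq> ?C" "card (set w) = Suc j"
    using Suc by auto
  have "origin d \<in> set w" using w by (cases w) (auto simp: walks_def)
  moreover have "set w \<noteq> ?C" using w Suc.prems by auto
  ultimately obtain x y where xy: "x \<in> set w" "y \<in> ?C" "y \<notin> set w" "adj x y"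
    using origin_component_escape[OF w(2)] by blast
  obtain us vs where split: "w = us @ x # vs" using xy(1) by (auto simp: in_set_conv_decomp)
  let ?w = "us @ x # y # x # vs"
  have "?w \<in> walks (origin d) (2 * Suc j)"
  proof -
    have "hd ?w = hd w" by (cases us) (simp_all add: split)
    moreover have "successively adj ?w"
      using w(1) xy(4) adj_sym[of x y] unfolding split walks_def
      by (auto simp: successively_append_iff successively_Cons)
    ultimately show ?thesis using w(1) by (simp add: walks_def split)
  qed
  moreover have "set ?w = insert y (set w)" by (auto simp: split)
  ultimately show ?case using w xy by (intro bexI[of _ ?w]) auto
qed

text \<open>A shape of size \<open>Suc j\<close> is the range of a walk of \<open>2 * j\<close>
  steps from the origin, and each step has at most \<open>2 * d\<close> choices.\<close>

lemma cluster_shapes_le: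
  assumes "d > 0"
  shows "finite (cluster_shapes d m) \<and> card (cluster_shapes d m) \<le> ((2 * d)\<^sup>2) ^ m"
proof (cases m)
  case 0
  have "C = {}" if "C \<in> cluster_shapes d m" for C
  proof -
    from that 0 obtain F where F: "finite F" "C = origin_component d F" "card C = 0"
      unfolding cluster_shapes_def by blast
    then show ?thesis using finite_subset[OF origin_component_subset F(1)] by auto
  qed
  then have "cluster_shapes d m \<subseteq> {{}}" by auto
  then show ?thesis using 0 card_mono[of "{{}}" "cluster_shapes d m"] finite_subset by fastforce
next
  case (Suc j)
  have fin: "finite (walks (origin d) (2 * j))" "card (walks (origin d) (2 * j)) \<le> (2 * d) ^ (2 * j)"
    using walks_card_le[of "origin d" d] by (auto simp: origin_def sites_def)
  have sub: "cluster_shapes d m \<subseteq> set ` walks (origin d) (2 * j)"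
  proof
    fix C assume "C \<in> cluster_shapes d m"
    then obtain F where F: "finite F" "C = origin_component d F" "card C = Suc j"
      using Suc by (auto simp: cluster_shapes_def)
    then have C: "finite C" using origin_component_subset finite_subset by blast
    then obtain w where w: "w \<in> walks (origin d) (2 * j)" "set w \<subseteq> C" "card (set w) = Suc j"
      using origin_component_walk[of d F j] F by auto
    then have "set w = C" using F C card_subset_eq by metis
    then show "C \<in> set ` walks (origin d) (2 * j)" using w by blast
  qed
  have "card (cluster_shapes d m) \<le> card (walks (origin d) (2 * j))"
    using sub fin card_mono[OF finite_imageI[OF fin(1)] sub] card_image_le[OF fin(1), of set] by linarith
  also have "\<dots> \<le> (2 * d) ^ (2 * j)" by (rule fin)
  also have "\<dots> \<le> (2 * d) ^ (2 * m)" using assms Suc by (intro power_increasing) auto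
  finally show ?thesis using sub fin finite_subset by (metis finite_imageI power_mult)
qed

section \<open>In one dimension clusters are intervals\<close>

lemma sites_1: "x \<in> sites 1 \<longleftrightarrow> (\<exists>k. x = [k])"
  by (auto simp: sites_def length_Suc_conv)

lemma adj_singleton: "adj [j] [k] \<longleftrightarrow> \<bar>j - k\<bar> = 1"
  by (simp add: adj_def)

text \<open>Discrete intermediate values: one step of a path changes the coordinate by one, so the
  interval from zero to the endpoint gains at most the new endpoint.\<close>

lemma origin_component_1_between:
  assumes F: "F \<subseteq> sites 1" and k: "[k] \<in> origin_component 1 F"
    and j: "j \<in> {min 0 k..max 0 k}"
  shows "[j] \<in> origin_component 1 F"
proof -
  let ?C = "origin_component 1 F"
  have "\<forall>j\<in>{min 0 (hd y)..max 0 (hd y)}. [j] \<in> ?C" if "y \<in> ?C" for y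
  proof -
    from that have or: "origin 1 \<in> F" and "(\<lambda>a b. a \<in> F \<and> b \<in> F \<and> adj a b)\<^sup>*\<^sup>* (origin 1) y"
      by (auto simp: origin_component_def)
    from this(2) have "y \<in> ?C \<and> (\<forall>j\<in>{min 0 (hd y)..max 0 (hd y)}. [j] \<in> ?C)"
    proof induction
      case base
      then show ?case using or by (auto simp: origin_component_def origin_def)
    next
      case (step y z)
      then have "y \<in> sites 1" "z \<in> sites 1" using F by auto
      then obtain a b where ab: "y = [a]" "z = [b]" unfolding sites_1 by auto
      have "z \<in> ?C" using step origin_component_closed by blast
      moreover have "j = b \<or> j \<in> {min 0 a..max 0 a}" if "j \<in> {min 0 b..max 0 b}" for j
        using step(2) that unfolding ab adj_singleton by auto
      ultimately show ?case using step.IH unfolding ab list.sel by blast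
    qed
    then show ?thesis by simp
  qed
  from this[OF k] show ?thesis using j by simp
qed

lemma cluster_shapes_1:
  assumes "C \<in> cluster_shapes 1 m" "m > 0"
  shows "\<exists>a\<in>{- int m<..0}. C = (\<lambda>k. [k]) ` {a..<a + int m}"
proof -
  obtain F where F: "finite F" "F \<subseteq> sites 1" "C = origin_component 1 F" "card C = m"
    using assms by (auto simp: cluster_shapes_def)
  have CF: "C \<subseteq> F" using F origin_component_subset by blast
  define J where "J = {k. [k] \<in> C}"
  have "\<exists>k. x = [k]" if "x \<in> C" for x using that CF F(2) sites_1[of x] by auto
  then have CJ: "C = (\<lambda>k. [k]) ` J" unfolding J_def by blast
  have "finite C" using CF F(1) finite_subset by blast
  then have fin: "finite J" unfolding CJ by (rule finite_imageD) (simp add: inj_on_def)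
  have cJ: "card J = m" using F(4) unfolding CJ by (simp add: card_image inj_on_def)
  have "C \<noteq> {}" using assms(2) F(4) by auto
  then have "[0] \<in> C" unfolding F(3) by (auto simp: origin_component_def origin_def)
  then have J0: "0 \<in> J" by (simp add: J_def)
  have J: "J = {Min J..Max J}"
  proof
    show "{Min J..Max J} \<subseteq> J"
    proof
      fix j assume j: "j \<in> {Min J..Max J}"
      have "Min J \<in> J" "Max J \<in> J" using fin J0 by (auto intro!: Min_in Max_in)
      moreover have "Min J \<le> 0" "0 \<le> Max J" using fin J0 by auto
      ultimately show "j \<in> J"
        using origin_component_1_between[OF F(2), of "Min J" j]
          origin_component_1_between[OF F(2), of "Max J" j] j
        unfolding J_def F(3) by fastforce
    qed
  qed (use fin in auto)
  then obtain a b where ab: "J = {a..b}" by blast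
  have "a \<le> 0" "0 \<le> b" "nat (b - a + 1) = m" using J0 cJ unfolding ab by simp_all
  then have "J = {a..<a + int m}" "a \<in> {- int m<..0}" unfolding ab by auto
  then show ?thesis using CJ by blast
qed

text \<open>There are \<open>m\<close> intervals of size \<open>m\<close> through the origin;
  \<open>Suc m\<close> also covers size zero, where the empty set is one shape.\<close>

lemma card_cluster_shapes_1: "finite (cluster_shapes 1 m) \<and> card (cluster_shapes 1 m) \<le> Suc m"
proof (cases "m = 0")
  case True
  then show ?thesis using cluster_shapes_le[of 1 0] by simp
next
  case False
  let ?S = "(\<lambda>a. (\<lambda>k. [k]) ` {a..<a + int m}) ` {- int m<..0}"
  have sub: "cluster_shapes 1 m \<subseteq> ?S" using cluster_shapes_1 False by blast
  have fin: "finite ?S" by simp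
  have "card (cluster_shapes 1 m) \<le> card ?S" by (rule card_mono[OF fin sub])
  also have "\<dots> \<le> card {- int m<..0}" by (rule card_image_le) simp
  also have "\<dots> = m" by simp
  finally show ?thesis using finite_subset[OF sub fin] by simp
qed

section \<open>Exponential decay\<close>

text \<open>Removes the prefactor \<open>A\<close>. For large \<open>n\<close> part of the decay
  absorbs it; for the finitely many remaining \<open>n \<ge> 1\<close> the uniform bound below one
  suffices if the rate is small.\<close>

lemma exp_tail_bound:
  fixes f :: "nat \<Rightarrow> real"
  assumes tail: "\<And>n. f n \<le> A * s ^ n" and s: "0 < s" "s < 1"
    and one: "f 0 \<le> 1" and less: "\<And>n. n \<ge> 1 \<Longrightarrow> f n \<le> \<delta>" "\<delta> < 1"
  shows "\<exists>c>0. \<forall>n. f n \<le> exp (- c * real n)"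
proof -
  \<comment> \<open>Of the two factors in \<open>s ^ n = r ^ n * r ^ n\<close> one absorbs
    \<open>A\<close>, the other remains as decay.\<close>
  define r where "r = sqrt s"
  have r: "0 < r" "r < 1" "s = r * r" using s by (auto simp: r_def)
  have "(\<lambda>n. A * r ^ n) \<longlonglongrightarrow> A * 0"
    using r by (intro tendsto_mult tendsto_const LIMSEQ_realpow_zero) auto
  then have "\<forall>\<^sub>F n in sequentially. A * r ^ n < 1"
    by (intro order_tendstoD(2)[of _ "A * 0"]) auto
  then obtain N where N: "\<And>n. n \<ge> N \<Longrightarrow> A * r ^ n < 1" unfolding eventually_sequentially by blast
  define M where "M = Suc N"
  \<comment> \<open>The maximum keeps the argument of the logarithm positive even when
    \<open>\<delta>\<close> is not.\<close>
  define e where "e = max \<delta> (1 / 2)"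
  have e: "0 < e" "e < 1" "\<delta> \<le> e" using less(2) by (auto simp: e_def)
  define c where "c = min (- ln r) (- ln e / real M)"
  have c: "c > 0" "c \<le> - ln r" "c \<le> - ln e / real M"
    using r e by (auto simp: c_def M_def divide_neg_pos)
  have "f n \<le> exp (- c * real n)" for n
  proof -
    consider "n = 0" | "1 \<le> n" "n \<le> M" | "M \<le> n" by linarith
    then show ?thesis
    proof cases
      case 1
      then show ?thesis using one by simp
    next
      case 2
      have "c * real n \<le> (- ln e / real M) * real M"
        using c 2 by (intro mult_mono) auto
      then have "ln e \<le> - c * real n" by (simp add: M_def)
      then have "exp (ln e) \<le> exp (- c * real n)" by (simp only: exp_le_cancel_iff)
      then show ?thesis using less(1)[OF 2(1)] e by simp
    next
      case 3
      have "f n \<le> (A * r ^ n) * r ^ n" using tail[of n] by (simp add: r(3) power_mult_distrib)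
      also have "\<dots> \<le> 1 * r ^ n"
        using N[of n] 3 r by (intro mult_right_mono) (auto simp: M_def)
      also have "\<dots> = exp (real n * ln r)" using r by (simp add: exp_of_nat_mult)
      also have "\<dots> \<le> exp (- c * real n)"
        using mult_left_mono[OF c(2), of "real n"] by (simp add: mult.commute)
      finally show ?thesis .
    qed
  qed
  then show ?thesis using c(1) by blast
qed

section \<open>Exponential moments and the final estimates\<close>

lemma integrable_real_pmf:
  assumes "integrable (measure_pmf p) (\<lambda>k. exp (1 * real k))"
  shows "integrable (measure_pmf p) real"
proof (rule Bochner_Integration.integrable_bound[OF assms])
  have "real k \<le> exp (real k)" for k using exp_ge_add_one_self[of "real k"] by linarith
  then show "AE k in measure_pmf p. norm (real k) \<le> norm (exp (1 * real k))" by simp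
qed simp

text \<open>To first order \<open>mgf p t\<close> is \<open>1 + t * \<rho>\<close>, which for small
  positive \<open>t\<close> stays below \<open>1 + t \<le> exp t\<close>.\<close>

lemma ex_mgf_less:
  assumes int: "\<And>t::real. integrable (measure_pmf p) (\<lambda>k. exp (t * real k))"
    and mean: "measure_pmf.expectation p real < 1"
  shows "\<exists>t>0. mgf p t * exp (- t) < 1"
proof -
  define \<rho> where "\<rho> = measure_pmf.expectation p real"
  \<comment> \<open>The second entry makes the error \<open>2 * t * t * mgf p 2\<close> at most half
    of \<open>t * (1 - \<rho>)\<close>; \<open>t \<le> 1\<close> allows
    \<open>exp (t * real k)\<close> to be bounded by \<open>exp (real k)\<close> in the
    remainder.\<close>
  define t where "t = min 1 ((1 - \<rho>) / (4 * mgf p 2))"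
  have M: "1 \<le> mgf p 2" using mgf_ge_1[OF int] by simp
  have t: "0 < t" "t \<le> 1" "t * (4 * mgf p 2) \<le> 1 - \<rho>"
    using mean M by (auto simp: t_def \<rho>_def min_def field_simps)
  have intk: "integrable (measure_pmf p) real" by (rule integrable_real_pmf[OF int])
  have bound: "exp (t * real k) \<le> 1 + t * real k + 2 * t\<^sup>2 * exp (2 * real k)" for k
  proof -
    let ?x = "t * real k"
    have x: "0 \<le> ?x" "?x \<le> real k" using t by (auto simp: mult_left_le_one_le)
    have k2: "(real k)\<^sup>2 \<le> 2 * exp (real k)"
      using exp_lower_Taylor_quadratic[of "real k"] by simp
    have "exp ?x \<le> 1 + ?x + ?x\<^sup>2 * exp ?x"
    proof -
      have "exp ?x - 1 \<le> ?x * exp ?x"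
        using exp_ge_add_one_self[of "- ?x"] by (simp add: exp_minus field_simps)
      then have "exp ?x - 1 - ?x \<le> ?x * (exp ?x - 1)" by (simp add: algebra_simps)
      also have "\<dots> \<le> ?x * (?x * exp ?x)"
        using \<open>exp ?x - 1 \<le> ?x * exp ?x\<close> x by (intro mult_left_mono)
      finally show ?thesis by (simp add: power2_eq_square algebra_simps)
    qed
    also have "?x\<^sup>2 * exp ?x \<le> t\<^sup>2 * (2 * exp (real k)) * exp (real k)"
      unfolding power_mult_distrib using x k2 by (intro mult_mono) auto
    also have "\<dots> = 2 * t\<^sup>2 * exp (2 * real k)" by (simp add: mult_exp_exp)
    finally show ?thesis by simp
  qed
  have "mgf p t \<le> measure_pmf.expectation p (\<lambda>k. 1 + t * real k + 2 * t\<^sup>2 * exp (2 * real k))"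
    unfolding mgf_def using int intk bound by (intro integral_mono) auto
  also have "\<dots> = 1 + t * \<rho> + 2 * t\<^sup>2 * mgf p 2"
    using int intk by (simp add: \<rho>_def mgf_def)
  also have "\<dots> < 1 + t"
  proof -
    have "t * (t * (4 * mgf p 2)) \<le> t * (1 - \<rho>)" using t by (intro mult_left_mono) auto
    moreover have "0 < t * (t * mgf p 2)" using t M by simp
    ultimately show ?thesis by (simp add: power2_eq_square algebra_simps)
  qed
  also have "\<dots> \<le> exp t" by simp
  finally show ?thesis using t by (intro exI[of _ t]) (simp add: exp_minus field_simps)
qed

lemma pmf_0_pos:
  assumes int: "\<And>t::real. integrable (measure_pmf p) (\<lambda>k. exp (t * real k))"
    and mean: "measure_pmf.expectation p real < 1"
  shows "0 < pmf p 0"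
proof (rule ccontr)
  assume "\<not> 0 < pmf p 0"
  then have "0 \<notin> set_pmf p" by (simp add: pmf_positive_iff)
  then have "1 \<le> real k" if "k \<in> set_pmf p" for k using that by (cases k) auto
  then have "AE k in measure_pmf p. 1 \<le> real k" by (simp add: AE_measure_pmf_iff)
  moreover have "integrable (measure_pmf p) real" by (rule integrable_real_pmf[OF int])
  ultimately have "measure_pmf.expectation p (\<lambda>_. 1) \<le> measure_pmf.expectation p real"
    by (intro integral_mono_AE) auto
  then show False using mean by simp
qed

text \<open>Bernoulli's inequality trades the linear factor for a slightly larger ratio.\<close>

lemma Suc_mult_power_le:
  fixes q c :: real
  assumes "0 \<le> q" "0 < c"
  shows "real (Suc m) * q ^ m \<le> (1 + 1 / c) * (q * (1 + c)) ^ m"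
proof -
  have "real (Suc m) \<le> (1 + 1 / c) * (1 + real m * c)" using assms by (simp add: field_simps)
  also have "\<dots> \<le> (1 + 1 / c) * (1 + c) ^ m"
    using assms by (intro mult_left_mono Bernoulli_inequality) auto
  finally have "real (Suc m) * q ^ m \<le> (1 + 1 / c) * (1 + c) ^ m * q ^ m"
    using assms by (intro mult_right_mono) auto
  then show ?thesis by (simp add: power_mult_distrib mult_ac)
qed

text \<open>If \<open>\<eta>\<close> vanishes on \<open>{-L..L}\<close> then a heavy interval around the origin has more than
  \<open>L\<close> sites. Vanishing is a product event, so it costs the same factor in the union bound for
  long intervals as in its own probability.\<close>
lemma prob_heavy_1_less_1:
  assumes int: "\<And>t::real. integrable (measure_pmf p) (\<lambda>k. exp (t * real k))"
    and mean: "measure_pmf.expectation p real < 1"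
    and tail: "\<And>W n. finite W \<Longrightarrow> W \<subseteq> sites 1 \<Longrightarrow>
      measure (sandpile_measure 1 p) (\<Union>m\<in>{n..}. heavy_event 1 p W m) \<le> pmf p 0 ^ card W * A * s ^ n"
    and s: "0 < s" "s < 1"
  shows "measure (sandpile_measure 1 p) (\<Union>m\<in>{1..}. heavy_event 1 p {} m) < 1"
proof -
  interpret prob_space "sandpile_measure 1 p" by (rule prob_space_sandpile)
  let ?M = "sandpile_measure 1 p"
  have "(\<lambda>n. A * s ^ n) \<longlonglongrightarrow> A * 0"
    using s by (intro tendsto_mult tendsto_const LIMSEQ_realpow_zero) auto
  then have "\<forall>\<^sub>F n in sequentially. A * s ^ n < 1"
    by (intro order_tendstoD(2)[of _ "A * 0"]) auto
  then obtain L where L: "A * s ^ L < 1" unfolding eventually_sequentially by blast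
  \<comment> \<open>A nonempty shape with fewer than \<open>L\<close> sites is an interval
    containing zero, so it lies in this window and has no mass there.\<close>
  define W where "W = (\<lambda>k. [k]) ` {- int L..int L}"
  have W: "finite W" "W \<subseteq> sites 1" by (auto simp: W_def sites_def)
  define H where "H = (\<Union>m\<in>{1..}. heavy_event 1 p {} m)"
  define Z where "Z = {\<eta> \<in> space ?M. \<forall>x\<in>W. \<eta> x = 0}"
  have fin: "finite (cluster_shapes 1 m)" for m using card_cluster_shapes_1 by blast
  have H: "H \<in> events"
    unfolding H_def by (intro sets.countable_UN' image_subsetI sets_heavy_event[OF finite.emptyI empty_subsetI fin]) simp
  have Z: "Z \<in> events" using sets_vanishing_heavy[OF W, of "{}" p 0] by (simp add: Z_def)
  have HW: "(\<Union>m\<in>{L..}. heavy_event 1 p W m) \<in> events"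
    by (intro sets.countable_UN' image_subsetI sets_heavy_event[OF W fin]) simp
  have "Z \<inter> H \<subseteq> (\<Union>m\<in>{L..}. heavy_event 1 p W m)"
  proof
    fix \<eta> assume \<eta>: "\<eta> \<in> Z \<inter> H"
    then have zero: "\<And>x. x \<in> W \<Longrightarrow> \<eta> x = 0" and sp: "\<eta> \<in> space ?M" by (auto simp: Z_def)
    obtain m C where m: "m \<ge> 1" and C: "C \<in> cluster_shapes 1 m" and sum: "1 * m \<le> (\<Sum>x\<in>C. \<eta> x)"
      using \<eta> by (auto simp: H_def heavy_event_def)
    have "L \<le> m"
    proof (rule ccontr)
      assume "\<not> L \<le> m"
      then have "C \<subseteq> W" using cluster_shapes_1[OF C] m by (fastforce simp: W_def)
      then have "(\<Sum>x\<in>C. \<eta> x) = 0" using zero by (intro sum.neutral) auto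
      then show False using m sum by simp
    qed
    moreover have "\<eta> \<in> heavy_event 1 p W m"
      using C sum zero sp by (auto simp: heavy_event_def)
    ultimately show "\<eta> \<in> (\<Union>m\<in>{L..}. heavy_event 1 p W m)" by auto
  qed
  then have "prob (Z \<inter> H) \<le> prob (\<Union>m\<in>{L..}. heavy_event 1 p W m)"
    by (rule finite_measure_mono[OF _ HW])
  also have "\<dots> \<le> pmf p 0 ^ card W * (A * s ^ L)" using tail[OF W, of L] by simp
  also have "\<dots> < pmf p 0 ^ card W * 1"
    using L pmf_0_pos[OF int mean] by (intro mult_strict_left_mono) auto
  also have "pmf p 0 ^ card W * 1 = prob Z" using prob_vanishing[OF W, of p] by (simp add: Z_def)
  finally have "prob (Z \<inter> H) < prob Z" .
  then have "0 < prob (Z - H)" using finite_measure_Diff'[OF Z H] by simp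
  also have "prob (Z - H) \<le> prob (space ?M - H)"
    using Z H sets.sets_into_space[OF Z] by (intro finite_measure_mono) auto
  also have "\<dots> = 1 - prob H" by (rule prob_compl[OF H])
  finally show ?thesis by (simp add: H_def)
qed

lemma big_cluster_decay_1:
  assumes int: "\<And>t::real. integrable (measure_pmf p) (\<lambda>k. exp (t * real k))"
    and mean: "measure_pmf.expectation p real < 1"
  shows "\<exists>c>0. \<forall>n. measure (sandpile_measure 1 p) (big_cluster_event 1 p n) \<le> exp (- c * real n)"
proof -
  interpret prob_space "sandpile_measure 1 p" by (rule prob_space_sandpile)
  obtain t where t: "t > 0" "mgf p t * exp (- t) < 1" using ex_mgf_less[OF int mean] by blast
  define q where "q = mgf p t * exp (- t)"
  have q: "0 < q" "q < 1" using t mgf_ge_1[OF int[of t]] by (auto simp: q_def)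
  \<comment> \<open>This value puts \<open>s\<close> halfway between \<open>q\<close> and
    one.\<close>
  define c where "c = (1 - q) / (2 * q)"
  define s where "s = q * (1 + c)"
  have c: "0 < c" using q by (simp add: c_def)
  have "s = (q + 1) / 2" using q by (simp add: s_def c_def field_simps)
  then have s: "0 < s" "s < 1" using q by auto
  have fin: "finite (cluster_shapes 1 m)" for m using card_cluster_shapes_1 by blast
  have shapes: "real (card (cluster_shapes 1 m)) * (mgf p t * exp (- t * real 1)) ^ m
      \<le> (1 + 1 / c) * s ^ m" for m
  proof -
    have "real (card (cluster_shapes 1 m)) * q ^ m \<le> real (Suc m) * q ^ m"
      using card_cluster_shapes_1 q by (intro mult_right_mono) (simp_all only: of_nat_le_iff zero_le_power less_imp_le)
    also have "\<dots> \<le> (1 + 1 / c) * s ^ m" unfolding s_def using q c by (intro Suc_mult_power_le) auto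
    finally show ?thesis by (simp add: q_def)
  qed
  define A where "A = (1 + 1 / c) / (1 - s)"
  have tail: "prob (\<Union>m\<in>{n..}. heavy_event 1 p W m) \<le> pmf p 0 ^ card W * A * s ^ n"
    if "finite W" "W \<subseteq> sites 1" for W n
    using prob_heavy_tail_le[OF that int _ fin shapes, of n] s t by (simp add: A_def)
  let ?T = "\<lambda>n. \<Union>m\<in>{n..}. heavy_event 1 p {} m"
  have T: "?T n \<in> events" for n by (intro sets.countable_UN' image_subsetI sets_heavy_event[OF finite.emptyI empty_subsetI fin]) simp
  have "\<exists>c>0. \<forall>n. prob (?T n) \<le> exp (- c * real n)"
  \<comment> \<open>For small \<open>n\<close> the geometric bound may exceed one; there
    \<open>prob (?T 1) < 1\<close> from the vanishing window takes over.\<close>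
  proof (rule exp_tail_bound[OF _ s _ _ prob_heavy_1_less_1[OF int mean tail s]])
    show "prob (?T n) \<le> A * s ^ n" for n using tail[of "{}" n] by simp
    show "prob (?T n) \<le> prob (?T 1)" if "n \<ge> 1" for n
      using that by (intro finite_measure_mono T UN_mono) simp_all
    show "prob (?T 0) \<le> 1" by (rule prob_le_1)
  qed
  moreover have "prob (big_cluster_event 1 p n) \<le> prob (?T n)" for n
    by (intro finite_measure_mono big_cluster_event_subset T)
  ultimately show ?thesis by (meson le_trans order_trans)
qed

text \<open>With ratio \<open>1 / 4\<close> the tail is at most \<open>4 / 3 * (1 / 4) ^ n\<close>,
  hence at most \<open>1 / 3\<close> from \<open>n = 1\<close> on, so the union bound alone controls
  small sizes.\<close>

lemma big_cluster_decay:
  assumes int: "\<And>t::real. integrable (measure_pmf p) (\<lambda>k. exp (t * real k))"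
    and d: "d > 0" and t: "0 \<le> t" "real ((2 * d)\<^sup>2) * (mgf p t * exp (- t * real d)) \<le> 1 / 4"
  shows "\<exists>c>0. \<forall>n. measure (sandpile_measure d p) (big_cluster_event d p n) \<le> exp (- c * real n)"
proof -
  interpret prob_space "sandpile_measure d p" by (rule prob_space_sandpile)
  let ?q = "mgf p t * exp (- t * real d)"
  have fin: "finite (cluster_shapes d m)" for m using cluster_shapes_le[OF d] by blast
  have q: "0 \<le> ?q" using mgf_ge_1[OF int t(1)] by simp
  have shapes: "real (card (cluster_shapes d m)) * ?q ^ m \<le> 1 * (1 / 4) ^ m" for m
  proof -
    have "real (card (cluster_shapes d m)) * ?q ^ m \<le> real (((2 * d)\<^sup>2) ^ m) * ?q ^ m"
      using cluster_shapes_le[OF d, of m] q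
      by (intro mult_right_mono) (simp_all only: of_nat_le_iff zero_le_power)
    also have "\<dots> = (real ((2 * d)\<^sup>2) * ?q) ^ m"
      unfolding of_nat_power[of "(2 * d)\<^sup>2" m] by (rule power_mult_distrib[symmetric])
    also have "\<dots> \<le> (1 / 4) ^ m" using t(2) q by (intro power_mono) auto
    finally show ?thesis by simp
  qed
  let ?T = "\<lambda>n. \<Union>m\<in>{n..}. heavy_event d p {} m"
  have T: "?T n \<in> events" for n by (intro sets.countable_UN' image_subsetI sets_heavy_event[OF finite.emptyI empty_subsetI fin]) simp
  have tail: "prob (?T n) \<le> 4 / 3 * (1 / 4) ^ n" for n
    using prob_heavy_tail_le[of "{}", OF _ _ int t(1) fin shapes, of n] by simp
  have "\<exists>c>0. \<forall>n. prob (?T n) \<le> exp (- c * real n)"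
  proof (rule exp_tail_bound[OF tail])
    show "prob (?T n) \<le> 1 / 3" if "n \<ge> 1" for n
      using tail[of n] power_decreasing[OF that, of "1 / 4 :: real"] by simp
  qed auto
  moreover have "prob (big_cluster_event d p n) \<le> prob (?T n)" for n
    by (intro finite_measure_mono big_cluster_event_subset T)
  ultimately show ?thesis by (meson le_trans order_trans)
qed

text \<open>Cauchy--Schwarz in the form \<open>G(t) - 1 \<le> sqrt (G(2t) * P(\<eta> > 0))\<close>: if \<open>G(t)\<close> does not
  come close to \<open>1\<close> as the mean tends to \<open>0\<close>, then \<open>G(2t)\<close> blows up.\<close>
lemma mgf_double_large:
  assumes int: "\<And>t::real. integrable (measure_pmf p) (\<lambda>k. exp (t * real k))"
    and mean: "measure_pmf.expectation p real = \<rho>" and \<rho>: "0 < \<rho>"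
    and large: "2 < mgf p t" and t: "0 \<le> t"
  shows "1 / \<rho> < mgf p (2 * t)"
proof -
  have intk: "integrable (measure_pmf p) real" by (rule integrable_real_pmf[OF int])
  \<comment> \<open>Expanding \<open>(\<rho> * ?y - 1)\<close> squared gives a weighted Young
    inequality. Replacing the constant by \<open>real k / (2 * \<rho>)\<close>, allowed for
    \<open>k \<ge> 1\<close>, makes that term average to \<open>1 / 2\<close>; at
    \<open>k = 0\<close> the left side vanishes.\<close>
  have bound: "exp (t * real k) - 1 \<le> \<rho> / 2 * exp (2 * t * real k) + real k / (2 * \<rho>)" for k
  proof (cases "k = 0")
    case False
    let ?y = "exp (t * real k)"
    have y2: "exp (2 * t * real k) = ?y * ?y" by (simp add: mult_exp_exp algebra_simps)
    have "0 \<le> (\<rho> * ?y - 1)\<^sup>2" by simp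
    then have "2 * \<rho> * ?y \<le> \<rho> * \<rho> * (?y * ?y) + 1" by (simp add: power2_eq_square algebra_simps)
    then have "?y \<le> \<rho> / 2 * (?y * ?y) + 1 / (2 * \<rho>)" using \<rho> by (simp add: field_simps)
    also have "1 / (2 * \<rho>) \<le> real k / (2 * \<rho>)" using False \<rho> by (intro divide_right_mono) auto
    finally show ?thesis unfolding y2 by linarith
  qed (use \<rho> in simp)
  have "measure_pmf.expectation p (\<lambda>k. exp (t * real k) - 1)
      \<le> measure_pmf.expectation p (\<lambda>k. \<rho> / 2 * exp (2 * t * real k) + real k / (2 * \<rho>))"
    using int intk bound by (intro integral_mono) auto
  then have "mgf p t - 1 \<le> \<rho> / 2 * mgf p (2 * t) + \<rho> / (2 * \<rho>)"
    using int intk by (simp add: mgf_def mean)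
  then have "1 < \<rho> * mgf p (2 * t)" using large \<rho> by simp
  then show ?thesis using \<rho> by (simp add: field_simps)
qed

text \<open>The integrand increases in its parameter, so the level set lies below \<open>T\<close>;
  \<open>1 \<le> a\<close> makes it nonempty, as it contains zero.\<close>

lemma Sup_mgf_le:
  assumes int: "\<And>t::real. integrable (measure_pmf p) (\<lambda>k. exp (t * real k))"
    and a: "1 \<le> a" "a < mgf p T"
  shows "Sup {x. mgf p x \<le> a} \<le> T"
proof (rule cSup_least)
  show "{x. mgf p x \<le> a} \<noteq> {}" using a by (auto simp: mgf_def intro!: exI[of _ 0])
  show "x \<le> T" if "x \<in> {x. mgf p x \<le> a}" for x
  proof (rule ccontr)
    assume "\<not> x \<le> T"
    then have "mgf p T \<le> mgf p x"
      unfolding mgf_def using int by (intro integral_mono) (auto intro: mult_right_mono)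
    then show False using that a by simp
  qed
qed

text \<open>For a fixed \<open>t\<close>, if \<open>mgf (P \<rho>) t\<close> exceeded 2, then
  \<open>mgf (P \<rho>) (2 * t)\<close> would exceed \<open>1 / \<rho>\<close> and the supremum in
  the hypothesis would be at most \<open>2 * t\<close>, which fails for small
  \<open>\<rho>\<close>.\<close>

lemma big_cluster_decay_family:
  fixes P :: "real \<Rightarrow> nat pmf"
  assumes d: "d > 0"
    and int: "\<And>\<rho> t. 0 < \<rho> \<Longrightarrow> \<rho> < 1 \<Longrightarrow> integrable (measure_pmf (P \<rho>)) (\<lambda>k. exp (t * real k))"
    and mean: "\<And>\<rho>. 0 < \<rho> \<Longrightarrow> \<rho> < 1 \<Longrightarrow> measure_pmf.expectation (P \<rho>) real = \<rho>"
    and Sup: "filterlim (\<lambda>\<rho>. Sup {x. mgf (P \<rho>) x \<le> 1 / \<rho>}) at_top (at_right 0)"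
  shows "\<exists>\<rho>0>0. \<rho>0 \<le> 1 \<and> (\<forall>\<rho>. 0 < \<rho> \<and> \<rho> < \<rho>0 \<longrightarrow> (\<exists>c>0. \<forall>n.
    measure (sandpile_measure d (P \<rho>)) (big_cluster_event d (P \<rho>) n) \<le> exp (- c * real n)))"
proof -
  define K where "K = real ((2 * d)\<^sup>2)"
  \<comment> \<open>Since \<open>exp (t * real d) \<ge> t\<close>, the quantity in
    \<open>small\<close> is at most \<open>2 * K / t\<close>, which is \<open>1 / 4\<close>.\<close>
  define t where "t = 8 * K"
  have t: "0 \<le> t" by (simp add: t_def K_def)
  have small: "K * (2 * exp (- t * real d)) \<le> 1 / 4"
  proof -
    have "t * 1 \<le> t * real d" using d t by (intro mult_left_mono) auto
    then have "t \<le> exp (t * real d)" using exp_ge_add_one_self[of "t * real d"] by linarith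
    then show ?thesis by (simp add: t_def exp_minus field_simps)
  qed
  have "\<forall>\<^sub>F \<rho> in at_right 0. 2 * t < Sup {x. mgf (P \<rho>) x \<le> 1 / \<rho>}"
    using Sup by (simp add: filterlim_at_top_dense)
  then obtain b where b: "b > 0"
    "\<And>\<rho>. 0 < \<rho> \<Longrightarrow> \<rho> < b \<Longrightarrow> 2 * t < Sup {x. mgf (P \<rho>) x \<le> 1 / \<rho>}"
    unfolding eventually_at_right_field by auto
  have "\<exists>c>0. \<forall>n. measure (sandpile_measure d (P \<rho>)) (big_cluster_event d (P \<rho>) n) \<le> exp (- c * real n)"
    if \<rho>: "0 < \<rho>" "\<rho> < min b 1" for \<rho>
  proof (rule big_cluster_decay[OF int d t])
    have "mgf (P \<rho>) t \<le> 2"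
    proof (rule ccontr)
      assume "\<not> mgf (P \<rho>) t \<le> 2"
      then have "1 / \<rho> < mgf (P \<rho>) (2 * t)"
        using \<rho> t by (intro mgf_double_large int mean) auto
      then have "Sup {x. mgf (P \<rho>) x \<le> 1 / \<rho>} \<le> 2 * t"
        using \<rho> by (intro Sup_mgf_le int) auto
      then show False using b(2)[of \<rho>] \<rho> by simp
    qed
    then have "K * (mgf (P \<rho>) t * exp (- t * real d)) \<le> K * (2 * exp (- t * real d))"
      by (intro mult_left_mono mult_right_mono) (auto simp: K_def)
    then show "real ((2 * d)\<^sup>2) * (mgf (P \<rho>) t * exp (- t * real d)) \<le> 1 / 4"
      using small unfolding K_def by linarith
  qed (use \<rho> in auto)
  then show ?thesis using b(1) by (intro exI[of _ "min b 1"]) auto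
qed

theorem theorem4p2:
  shows "(\<forall>p :: nat pmf.
           (\<forall>t::real. integrable (measure_pmf p) (\<lambda>k. exp (t * real k))) \<and>
           measure_pmf.expectation p real < 1 \<longrightarrow>
           (\<exists>c>0. \<forall>n::nat.
              big_cluster_event 1 p n \<in> sets (sandpile_measure 1 p) \<and>
              measure (sandpile_measure 1 p) (big_cluster_event 1 p n) \<le> exp (- c * real n))) \<and>
         (\<forall>(d::nat) (P :: real \<Rightarrow> nat pmf).
           d > 1 \<and>
           (\<forall>\<rho>. 0 < \<rho> \<and> \<rho> < 1 \<longrightarrow>
              (\<forall>t::real. integrable (measure_pmf (P \<rho>)) (\<lambda>k. exp (t * real k))) \<and>
              measure_pmf.expectation (P \<rho>) real = \<rho>) \<and>
           (\<forall>a :: real \<Rightarrow> real.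
              (\<forall>\<rho>. 0 < \<rho> \<and> \<rho> < 1 \<longrightarrow> a \<rho> \<ge> 0) \<and> filterlim a at_top (at_right 0) \<longrightarrow>
              filterlim (\<lambda>\<rho>. Sup {x. mgf (P \<rho>) x \<le> a \<rho>}) at_top (at_right 0))
           \<longrightarrow>
           (\<exists>\<rho>0>0. \<rho>0 \<le> 1 \<and> (\<forall>\<rho>. 0 < \<rho> \<and> \<rho> < \<rho>0 \<longrightarrow>
              (\<exists>c>0. \<forall>n::nat.
                 big_cluster_event d (P \<rho>) n \<in> sets (sandpile_measure d (P \<rho>)) \<and>
                 measure (sandpile_measure d (P \<rho>)) (big_cluster_event d (P \<rho>) n)
                   \<le> exp (- c * real n)))))"
proof (intro conjI allI impI)
  fix p :: "nat pmf"
  assume "(\<forall>t::real. integrable (measure_pmf p) (\<lambda>k. exp (t * real k))) \<and>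
    measure_pmf.expectation p real < 1"
  then show "\<exists>c>0. \<forall>n::nat. big_cluster_event 1 p n \<in> sets (sandpile_measure 1 p) \<and>
      measure (sandpile_measure 1 p) (big_cluster_event 1 p n) \<le> exp (- c * real n)"
    using big_cluster_decay_1[of p] big_cluster_event_measurable[of 1 p] by blast
next
  fix d :: nat and P :: "real \<Rightarrow> nat pmf"
  assume hyp: "d > 1 \<and>
    (\<forall>\<rho>. 0 < \<rho> \<and> \<rho> < 1 \<longrightarrow>
      (\<forall>t::real. integrable (measure_pmf (P \<rho>)) (\<lambda>k. exp (t * real k))) \<and>
      measure_pmf.expectation (P \<rho>) real = \<rho>) \<and>
    (\<forall>a :: real \<Rightarrow> real. (\<forall>\<rho>. 0 < \<rho> \<and> \<rho> < 1 \<longrightarrow> a \<rho> \<ge> 0) \<and> filterlim a at_top (at_right 0) \<longrightarrow>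
      filterlim (\<lambda>\<rho>. Sup {x. mgf (P \<rho>) x \<le> a \<rho>}) at_top (at_right 0))"
  \<comment> \<open>Condition (iii) is applied to the level \<open>1 / \<rho>\<close> that
    \<open>mgf_double_large\<close> produces.\<close>
  have "filterlim (\<lambda>\<rho>::real. 1 / \<rho>) at_top (at_right 0)"
    using filterlim_inverse_at_top_right by (simp add: inverse_eq_divide)
  then have "filterlim (\<lambda>\<rho>. Sup {x. mgf (P \<rho>) x \<le> 1 / \<rho>}) at_top (at_right 0)"
    using hyp[THEN conjunct2, THEN conjunct2, rule_format, of "\<lambda>\<rho>. 1 / \<rho>"] by simp
  then have "\<exists>\<rho>0>0. \<rho>0 \<le> 1 \<and> (\<forall>\<rho>. 0 < \<rho> \<and> \<rho> < \<rho>0 \<longrightarrow> (\<exists>c>0. \<forall>n.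
      measure (sandpile_measure d (P \<rho>)) (big_cluster_event d (P \<rho>) n) \<le> exp (- c * real n)))"
    using hyp by (intro big_cluster_decay_family) auto
  then show "\<exists>\<rho>0>0. \<rho>0 \<le> 1 \<and> (\<forall>\<rho>. 0 < \<rho> \<and> \<rho> < \<rho>0 \<longrightarrow> (\<exists>c>0. \<forall>n::nat.
      big_cluster_event d (P \<rho>) n \<in> sets (sandpile_measure d (P \<rho>)) \<and>
      measure (sandpile_measure d (P \<rho>)) (big_cluster_event d (P \<rho>) n) \<le> exp (- c * real n)))"
    using big_cluster_event_measurable by simp
qed

end
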